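(* Let $d\ge2$ be an integer, let $\ell\ge 1$ be an even integer, and let $M,M'\in\{1,2,\dots,n_{\ell;d}\}$. Then $$\sum_{m_1,m_2=1}^{n_{\ell;d}}\mathcal G^{\ell,M}_{\ell,m_1,\ell,m_2;d}\;\mathcal G^{\ell,M'}_{\ell,m_1,\ell,m_2;d}=\delta_M^{M'}\,\frac{(n_{\ell;d})^2}{|\mathbb S^d|}\,\frac{|\mathbb S^{d-1}|}{|\mathbb S^d|}\int_{-1}^1 G_{\ell;d}(t)^3\left(\sqrt{1-t^2}\right)^{d-2}dt,$$ where $\mathcal G^{\ell,m_3}_{\ell,m_1,\ell,m_2;d}=\int_{\mathbb S^d}Y_{\ell,m_1;d}(x)\,Y_{\ell,m_2;d}(x)\,Y_{\ell,m_3;d}(x)\,dx$ and $\delta_M^{M'}$ is the Kronecker delta.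
   Context: $\mathbb S^d\subset\mathbb R^{d+1}$ is the unit sphere with its Lebesgue (surface) measure $dx$, of total mass $|\mathbb S^d|$ (and similarly $|\mathbb S^{d-1}|$). For an integer $\ell\ge1$, the eigenspace of the Laplace–Beltrami operator on $\mathbb S^d$ for the eigenvalue $-\ell(\ell+d-1)$ has dimension $n_{\ell;d}=\frac{2\ell+d-1}{\ell}\binom{\ell+d-2}{\ell-1}$, and $(Y_{\ell,m;d})_{m=1}^{n_{\ell;d}}$ is a real-valued orthonormal basis of it in $L^2(\mathbb S^d,dx)$ (hyperspherical harmonics). $G_{\ell;d}=\binom{\ell+d/2-1}{\ell}^{-1}P_\ell^{(d/2-1,d/2-1)}$ is the $\ell$-th Gegenbauer polynomial normalized by $G_{\ell;d}(1)=1$, where $P_\ell^{(a,b)}$ are the Jacobi polynomials (orthogonal on $[-1,1]$ for the weight $(1-t)^a(1+t)^b$). *)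

theory Defs
  imports "HOL-Analysis.Analysis"
begin

text \<open>
  The sphere \<open>sphere 0 1\<close> lies in a Euclidean space \<open>'a\<close>, so that its dimension is
  \<open>d = DIM('a) - 1\<close>. Functions on it are rendered as functions on all of \<open>'a\<close>, of which
  only the values on \<open>sphere 0 1\<close> matter.
\<close>

section \<open>Surface measure\<close>

text \<open>
  The surface measure of a Borel set \<open>A\<close> of the unit sphere is \<open>DIM('a)\<close> times the
  Lebesgue measure of the cone \<open>{r *\<^sub>R x | r x. 0 < r \<and> r < 1 \<and> x \<in> A}\<close> (polar coordinates).
\<close>

definition sphere_measure :: "'a::euclidean_space measure" where
  "sphere_measure =
     scale_measure (of_nat DIM('a))
       (distr (restrict_space lborel (ball 0 1 - {0})) (restrict_space borel (sphere 0 1))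
          (\<lambda>x. x /\<^sub>R norm x))"

definition sphere_area :: "'a::euclidean_space itself \<Rightarrow> real" where
  "sphere_area _ = measure (sphere_measure :: 'a measure) (sphere 0 1)"

lemma space_sphere_measure [simp]: "space sphere_measure = sphere 0 1"
  by (simp add: sphere_measure_def space_restrict_space space_scale_measure)

lemma sets_sphere_measure [simp, measurable_cong]:
  "sets sphere_measure = sets (restrict_space borel (sphere 0 1))"
  by (simp add: sphere_measure_def)

lemma measurable_radial_projection:
  "(\<lambda>x::'a::euclidean_space. x /\<^sub>R norm x) \<in>
     restrict_space lborel (ball 0 1 - {0}) \<rightarrow>\<^sub>M restrict_space borel (sphere 0 1)"
  by (intro measurable_restrict_space2) (auto simp: space_restrict_space intro!: measurable_restrict_space1)

lemma emeasure_sphere_measure: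
  fixes A :: "'a::euclidean_space set"
  assumes "A \<in> sets borel" "A \<subseteq> sphere 0 1"
  shows "emeasure sphere_measure A =
           of_nat DIM('a) * emeasure lborel {x \<in> ball 0 1 - {0}. x /\<^sub>R norm x \<in> A}"
proof -
  have A: "A \<in> sets (restrict_space borel (sphere 0 1))"
    using assms by (auto simp: sets_restrict_space)
  have [simp]: "(ball 0 1 - {0} :: 'a set) \<in> sets lborel"
    by simp
  have "emeasure (sphere_measure :: 'a measure) A = of_nat DIM('a) *
      emeasure (restrict_space lborel (ball 0 1 - {0}))
        ((\<lambda>x. x /\<^sub>R norm x) -` A \<inter> space (restrict_space lborel (ball 0 1 - {0})))"
    by (simp add: sphere_measure_def emeasure_distr[OF measurable_radial_projection A])
  also have "(\<lambda>x. x /\<^sub>R norm x) -` A \<inter> space (restrict_space lborel (ball 0 1 - {0})) =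
      {x \<in> ball 0 1 - {0}. x /\<^sub>R norm x \<in> A}"
    by (auto simp: space_restrict_space)
  also have "emeasure (restrict_space lborel (ball 0 1 - {0})) \<dots> = emeasure lborel \<dots>"
    by (rule emeasure_restrict_space) auto
  finally show ?thesis .
qed

section \<open>Laplace-Beltrami operator and its eigenspaces\<close>

text \<open>Twice continuously (Frechet) differentiable on an open set.\<close>

definition C2_on :: "'a::real_normed_vector set \<Rightarrow> ('a \<Rightarrow> real) \<Rightarrow> bool" where
  "C2_on U f \<longleftrightarrow>
     (\<exists>(f' :: 'a \<Rightarrow> 'a \<Rightarrow>\<^sub>L real) (f'' :: 'a \<Rightarrow> 'a \<Rightarrow>\<^sub>L 'a \<Rightarrow>\<^sub>L real).
        (\<forall>x\<in>U. (f has_derivative blinfun_apply (f' x)) (at x)) \<and>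
        (\<forall>x\<in>U. (f' has_derivative blinfun_apply (f'' x)) (at x)) \<and>
        continuous_on U f'')"

definition laplacian :: "('a::euclidean_space \<Rightarrow> real) \<Rightarrow> 'a \<Rightarrow> real" where
  "laplacian f x = (\<Sum>b\<in>Basis. deriv (deriv (\<lambda>t. f (x + t *\<^sub>R b))) 0)"

definition radial_extension :: "('a::real_normed_vector \<Rightarrow> real) \<Rightarrow> 'a \<Rightarrow> real" where
  "radial_extension f x = f (x /\<^sub>R norm x)"

text \<open>
  The Laplace-Beltrami operator of the round sphere applied to \<open>f\<close> is the restriction to the
  sphere of the Euclidean Laplacian of the extension of \<open>f\<close> that is constant along rays.
\<close>

definition laplace_beltrami :: "('a::euclidean_space \<Rightarrow> real) \<Rightarrow> 'a \<Rightarrow> real" where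
  "laplace_beltrami f = laplacian (radial_extension f)"

text \<open>
  Eigenfunctions are classical, that is, of class \<open>C\<^sup>2\<close> on the sphere. By elliptic regularity
  this is the same space as the weak \<open>L\<^sup>2\<close> eigenspace.
\<close>

definition laplace_beltrami_eigenspace :: "real \<Rightarrow> ('a::euclidean_space \<Rightarrow> real) set" where
  "laplace_beltrami_eigenspace c =
     {f. C2_on (- {0}) (radial_extension f) \<and>
         (\<forall>x\<in>sphere 0 1. laplace_beltrami f x = c * f x)}"

text \<open>
  \<open>Y\<close>, indexed by the finite set \<open>I\<close>, is an orthonormal basis of the space \<open>E\<close> of functions
  on the sphere; linear independence follows from orthonormality.
\<close>

definition L2_orthonormal_basis ::
    "('a::euclidean_space \<Rightarrow> real) set \<Rightarrow> 'i set \<Rightarrow> ('i \<Rightarrow> 'a \<Rightarrow> real) \<Rightarrow> bool" where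
  "L2_orthonormal_basis E I Y \<longleftrightarrow>
     finite I \<and>
     (\<forall>i\<in>I. Y i \<in> E) \<and>
     (\<forall>i\<in>I. \<forall>j\<in>I. (\<integral>x. Y i x * Y j x \<partial>sphere_measure) = (if i = j then 1 else 0)) \<and>
     (\<forall>f\<in>E. \<exists>c. \<forall>x\<in>sphere 0 1. f x = (\<Sum>i\<in>I. c i * Y i x))"

text \<open>The dimension of the eigenspace of degree \<open>l\<close> on the \<open>d\<close>-sphere; the division is exact.\<close>

definition harmonic_dim :: "nat \<Rightarrow> nat \<Rightarrow> nat" where
  "harmonic_dim l d = ((2 * l + d - 1) * ((l + d - 2) choose (l - 1))) div l"

lemma real_harmonic_dim:
  assumes "l \<ge> 1" "d \<ge> 2"
  shows "real (harmonic_dim l d) =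
           (2 * real l + real d - 1) / real l * real ((l + d - 2) choose (l - 1))"
proof -
  define k e where "k = l - 1" and "e = d - 2"
  have l: "l = Suc k" and d: "d = Suc (Suc e)"
    using assms by (simp_all add: k_def e_def)
  have "l * ((l + d - 2) choose l) = (d - 1) * ((l + d - 2) choose (l - 1))"
    using binomial_absorb_comp[of "Suc (k + e)" k] Suc_times_binomial_eq[of "k + e" k]
    unfolding l d by (simp del: binomial_Suc_Suc mult_Suc add: algebra_simps)
  hence "l dvd (d - 1) * ((l + d - 2) choose (l - 1))"
    by (metis dvd_triv_left)
  hence "l dvd 2 * l * ((l + d - 2) choose (l - 1)) + (d - 1) * ((l + d - 2) choose (l - 1))"
    by simp
  also have "\<dots> = (2 * l + d - 1) * ((l + d - 2) choose (l - 1))"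
    unfolding d by (simp add: algebra_simps)
  finally show ?thesis
    using assms by (simp add: harmonic_dim_def real_of_nat_div of_nat_diff)
qed

section \<open>Triple integrals\<close>

definition triple_integral ::
    "(nat \<Rightarrow> nat \<Rightarrow> 'a::euclidean_space \<Rightarrow> real) \<Rightarrow>
     nat \<Rightarrow> nat \<Rightarrow> nat \<Rightarrow> nat \<Rightarrow> nat \<Rightarrow> nat \<Rightarrow> real" where
  "triple_integral Y l1 m1 l2 m2 l3 m3 =
     (\<integral>x. Y l1 m1 x * Y l2 m2 x * Y l3 m3 x \<partial>sphere_measure)"

section \<open>Jacobi and Gegenbauer polynomials\<close>

text \<open>
  The hypergeometric form
  \<open>P\<^sub>n\<^sup>(\<^sup>a\<^sup>,\<^sup>b\<^sup>)(t) = (a+1)\<^sub>n / n! \<cdot> \<^sub>2F\<^sub>1(-n, n+a+b+1; a+1; (1-t)/2)\<close>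
  of the Jacobi polynomials, with the factors \<open>(a+1)\<^sub>k\<close> cancelled.
\<close>

definition jacobi_poly :: "real \<Rightarrow> real \<Rightarrow> nat \<Rightarrow> real \<Rightarrow> real" where
  "jacobi_poly a b n t =
     (\<Sum>k\<le>n. real (n choose k) * pochhammer (real n + a + b + 1) k *
        pochhammer (a + real k + 1) (n - k) * ((t - 1) / 2) ^ k) / fact n"

definition gegenbauer :: "nat \<Rightarrow> nat \<Rightarrow> real \<Rightarrow> real" where
  "gegenbauer l d t =
     inverse ((real l + real d / 2 - 1) gchoose l) *
     jacobi_poly (real d / 2 - 1) (real d / 2 - 1) l t"

lemma gegenbauer_at_1:
  assumes "d \<ge> 2"
  shows "gegenbauer l d 1 = 1"
proof -
  define a where "a = real d / 2 - 1"
  have a: "a \<ge> 0" using assms by (simp add: a_def)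
  have "jacobi_poly a a l 1 = pochhammer (a + 1) l / fact l"
    by (simp add: jacobi_poly_def sum.atMost_shift)
  moreover have "(real l + real d / 2 - 1) gchoose l = pochhammer (a + 1) l / fact l"
    by (simp add: gbinomial_pochhammer' a_def algebra_simps)
  moreover have "pochhammer (a + 1) l > 0"
    using a by (intro pochhammer_pos) auto
  ultimately show ?thesis
    by (simp add: gegenbauer_def a_def)
qed

end

theory Submission
  imports Defs
begin

text \<open>
  Write \<open>E\<close> for the eigenspace, \<open>N\<close> for its dimension, \<open>S\<close> for the sphere, and let
  \<open>K x y = (\<Sum>m. Y m x * Y m y)\<close> be the reproducing kernel of \<open>E\<close>. The sum in question is
  \<open>B M M' = (\<integral>x. \<integral>y. (K x y)\<^sup>2 * Y M x * Y M' y)\<close>, that is, the matrix in the basis \<open>Y\<close> of a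
  quadratic form on \<open>E\<close>. Orthogonal maps preserve both the surface measure and \<open>E\<close>, hence also
  \<open>K\<close> and this form; so the form should be a multiple of the scalar product, and the
  multiple is found by taking the trace.

  Irreducibility of \<open>E\<close> enters through a single fact, which replaces any averaging over the
  rotation group: an eigenfunction whose value at \<open>x\<close> depends only on \<open>x \<bullet> a\<close> is a multiple of
  the Gegenbauer polynomial in \<open>x \<bullet> a\<close> (\<open>zonal_eigenfunction_eq_gegenbauer\<close>). Along a
  meridian such a function satisfies a second order equation that is singular at the pole,
  and so does the Gegenbauer polynomial; an energy estimate shows that the regular solution is
  determined by its value at the pole (\<open>singular_ode_unique\<close>).

  Consequently any rotation invariant kernel \<open>k\<close> with \<open>k(\<cdot>, y)\<close> in \<open>E\<close> is a multiple of
  \<open>G(x \<bullet> y)\<close> (\<open>invariant_kernel_eq_gegenbauer\<close>). This applies to \<open>K = \<kappa> G\<close>, where integrating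
  the diagonal yields \<open>\<kappa> = N / |S|\<close>, and also to the kernel
  \<open>(\<Sum>M M'. B M M' * Y M x * Y M' y)\<close>. Since the two kernels are proportional, \<open>B\<close> is \<open>\<mu>\<close> times
  the identity matrix. Finally \<open>N \<mu>\<close> is the trace \<open>(\<integral>x. \<integral>y. K x y ^ 3)\<close>, which equals
  \<open>\<kappa> ^ 3 * |S|\<close> times the integral of \<open>G(x \<bullet> a) ^ 3\<close> over the sphere. That last integral is
  reduced to an integral over \<open>[-1, 1]\<close> by comparing moments (\<open>integral_sphere_zonal\<close>).
\<close>

section \<open>Orthogonal invariance of the surface measure\<close>

lemma orthogonal_transformation_borel:
  fixes T :: "'a::euclidean_space \<Rightarrow> 'a"
  assumes "orthogonal_transformation T"
  shows "T \<in> borel \<rightarrow>\<^sub>M borel"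
  using assms by (intro borel_measurable_continuous_onI linear_continuous_on)
    (simp add: orthogonal_transformation_def linear_linear)

lemma orthogonal_transformation_vimage_ball:
  fixes T :: "'a::euclidean_space \<Rightarrow> 'a"
  assumes T: "orthogonal_transformation T"
  shows "T -` ball c r = ball (inv T c) r"
proof -
  have "T (inv T c) = c" using T by (simp add: orthogonal_transformation_surj surj_f_inv_f)
  then have "dist c (T x) = dist (inv T c) x" for x
    using orthogonal_transformation_norm[OF T, of "inv T c - x"]
      linear_diff[OF orthogonal_transformation_linear[OF T], of "inv T c" x]
    by (simp add: dist_norm)
  then show ?thesis by auto
qed

text \<open>
  By Vitali's theorem an open set is, up to a null set, a countable disjoint union of balls, and
  an orthogonal map sends balls to balls of the same radius, hence of the same measure.
  Applied to \<open>T\<close> and to its inverse, this gives equality in the next theorem.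
\<close>

lemma emeasure_lborel_orthogonal_vimage_ge:
  fixes T :: "'a::euclidean_space \<Rightarrow> 'a"
  assumes T: "orthogonal_transformation T" and U: "open U"
  shows "emeasure lborel U \<le> emeasure lborel (T -` U)"
proof -
  define K where "K = {(c, r). 0 < r \<and> ball c r \<subseteq> U}"
  define B where "B = (\<lambda>i::'a \<times> real. ball (fst i) (snd i))"
  have "\<exists>i. i \<in> K \<and> x \<in> ball (fst i) (snd i) \<and> snd i < e" if "x \<in> U" "0 < e" for x e
  proof -
    obtain k where k: "k > 0" "ball x k \<subseteq> U" using U \<open>x \<in> U\<close> by (meson openE)
    then have "ball x (min k (e/2)) \<subseteq> U" by (meson ball_subset_ball_iff min.cobounded1 order_trans subset_ball)
    then show ?thesis using k \<open>0 < e\<close> by (intro exI[of _ "(x, min k (e/2))"]) (auto simp: K_def)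
  qed
  then obtain C where C: "countable C" "C \<subseteq> K"
      "pairwise (\<lambda>i j. disjnt (ball (fst i) (snd i)) (ball (fst j) (snd j))) C"
      and neg: "negligible (U - (\<Union>i\<in>C. ball (fst i) (snd i)))"
    using Vitali_covering_theorem_balls[of U K fst snd] by blast
  have disj: "disjoint_family_on B C"
    using C(3) by (auto simp: disjoint_family_on_def pairwise_def disjnt_def B_def)
  have disj': "disjoint_family_on (\<lambda>i. T -` B i) C"
    using disj unfolding disjoint_family_on_def by blast
  have B_sets: "B i \<in> sets lborel" "T -` B i \<in> sets lborel" for i
    by (auto simp: B_def orthogonal_transformation_vimage_ball[OF T])
  have UB_sets: "(\<Union>i\<in>C. B i) \<in> sets lborel"
    using C(1) B_sets by (intro sets.countable_UN') auto
  have "U - (\<Union>i\<in>C. B i) \<in> null_sets lborel"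
    using neg U UB_sets unfolding B_def[symmetric]
    by (auto simp: negligible_iff_null_sets null_sets_completion_iff)
  then have "emeasure lborel (U - (\<Union>i\<in>C. B i)) = 0" by auto
  moreover have "emeasure lborel U \<le> emeasure lborel ((\<Union>i\<in>C. B i) \<union> (U - (\<Union>i\<in>C. B i)))"
    using U UB_sets by (intro emeasure_mono) auto
  moreover have "\<dots> \<le> emeasure lborel (\<Union>i\<in>C. B i) + emeasure lborel (U - (\<Union>i\<in>C. B i))"
    using U UB_sets by (intro emeasure_subadditive) auto
  ultimately have "emeasure lborel U \<le> emeasure lborel (\<Union>i\<in>C. B i)" by auto
  also have "\<dots> = (\<integral>\<^sup>+i. emeasure lborel (B i) \<partial>count_space C)"
    using B_sets C(1) disj by (intro emeasure_UN_countable) auto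
  also have "\<dots> = (\<integral>\<^sup>+i. emeasure lborel (T -` B i) \<partial>count_space C)"
  proof (rule nn_integral_cong)
    fix i assume "i \<in> space (count_space C)"
    then have "0 < snd i" using C(2) by (auto simp: K_def)
    then show "emeasure lborel (B i) = emeasure lborel (T -` B i)"
      by (simp add: B_def orthogonal_transformation_vimage_ball[OF T] emeasure_ball)
  qed
  also have "\<dots> = emeasure lborel (\<Union>i\<in>C. T -` B i)"
    using B_sets C(1) disj' by (intro emeasure_UN_countable[symmetric]) auto
  also have "\<dots> \<le> emeasure lborel (T -` U)"
  proof (rule emeasure_mono)
    show "(\<Union>i\<in>C. T -` B i) \<subseteq> T -` U" using C(2) by (fastforce simp: K_def B_def)
    show "T -` U \<in> sets lborel"
      using measurable_sets[OF orthogonal_transformation_borel[OF T], of U] U by simp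
  qed
  finally show ?thesis .
qed

theorem distr_lborel_orthogonal:
  fixes T :: "'a::euclidean_space \<Rightarrow> 'a"
  assumes T: "orthogonal_transformation T"
  shows "distr lborel borel T = lborel"
proof -
  note iT = orthogonal_transformation_inv[OF T]
  have Tm: "T \<in> lborel \<rightarrow>\<^sub>M borel" using orthogonal_transformation_borel[OF T] by simp
  have eq: "emeasure (distr lborel borel T) U = emeasure lborel U" if U: "open U" for U
  proof -
    have "open (T -` U)"
      using T U by (intro open_vimage linear_continuous_on)
        (auto simp: orthogonal_transformation_def linear_linear)
    then have "emeasure lborel (T -` U) \<le> emeasure lborel (inv T -` (T -` U))"
      by (rule emeasure_lborel_orthogonal_vimage_ge[OF iT])
    also have "inv T -` (T -` U) = U"
      using orthogonal_transformation_surj[OF T] by (auto simp: surj_f_inv_f)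
    finally have "emeasure lborel (T -` U) = emeasure lborel U"
      using emeasure_lborel_orthogonal_vimage_ge[OF T U] by (simp add: antisym)
    then show ?thesis using U Tm by (simp add: emeasure_distr)
  qed
  show ?thesis
  proof (rule measure_eqI_generator_eq[where E = "{U. open U}" and \<Omega> = UNIV and A = "\<lambda>n. ball 0 (real n)"])
    show "(\<Union>i. ball (0::'a) (real i)) = UNIV" using reals_Archimedean2 by (auto simp: set_eq_iff)
    show "emeasure (distr lborel borel T) (ball 0 (real i)) \<noteq> \<infinity>" for i
      using emeasure_lborel_ball_finite[of "0::'a" "real i"] by (simp add: eq)
  qed (auto simp: eq Int_stable_def sets_borel)
qed

lemma orthogonal_transformation_measurable_sphere:
  fixes T :: "real^'n \<Rightarrow> real^'n"
  assumes T: "orthogonal_transformation T"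
  shows "T \<in> sphere_measure \<rightarrow>\<^sub>M sphere_measure"
proof -
  have "T \<in> borel \<rightarrow>\<^sub>M borel" by (rule orthogonal_transformation_borel[OF T])
  then have "T \<in> restrict_space borel (sphere 0 1) \<rightarrow>\<^sub>M restrict_space borel (sphere 0 1)"
    using T by (intro measurable_restrict_space2 measurable_restrict_space1)
      (auto simp: space_restrict_space orthogonal_transformation_norm)
  then show ?thesis by (simp cong: measurable_cong_sets)
qed

theorem distr_sphere_measure_orthogonal:
  fixes T :: "real^'n \<Rightarrow> real^'n"
  assumes T: "orthogonal_transformation T"
  shows "distr sphere_measure sphere_measure T = sphere_measure"
proof (rule measure_eqI)
  fix A assume "A \<in> sets (distr sphere_measure sphere_measure T)"
  then have A: "A \<in> sets borel" "A \<subseteq> sphere 0 1" by (auto simp: sets_restrict_space_iff)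
  note Tm = orthogonal_transformation_measurable_sphere[OF T]
  define C where "C B = {x \<in> ball 0 1 - {0}. x /\<^sub>R norm x \<in> B}" for B :: "(real^'n) set"
  have C_sets: "C B \<in> sets borel" if "B \<in> sets borel" "B \<subseteq> sphere 0 1" for B
  proof -
    have "B \<in> sets (restrict_space borel (sphere 0 1))" using that by (auto simp: sets_restrict_space_iff)
    from measurable_sets[OF measurable_radial_projection this]
    have "(\<lambda>x. x /\<^sub>R norm x) -` B \<inter> (ball 0 1 - {0}) \<in> sets borel"
      by (simp add: space_restrict_space sets_restrict_space_iff)
    also have "(\<lambda>x. x /\<^sub>R norm x) -` B \<inter> (ball 0 1 - {0}) = C B"
      unfolding C_def by blast
    finally show ?thesis .
  qed
  have "T -` A \<inter> sphere 0 1 \<in> sets sphere_measure"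
    using measurable_sets[OF Tm, of A] A by (auto simp: sets_restrict_space_iff)
  then have TA: "T -` A \<inter> sphere 0 1 \<in> sets borel" by (auto simp: sets_restrict_space_iff)
  have "emeasure (distr sphere_measure sphere_measure T) A =
      emeasure sphere_measure (T -` A \<inter> sphere 0 1)"
    using A by (subst emeasure_distr[OF Tm]) (auto simp: sets_restrict_space_iff)
  also have "\<dots> = of_nat DIM(real^'n) * emeasure lborel (C (T -` A \<inter> sphere 0 1))"
    unfolding C_def by (rule emeasure_sphere_measure[OF TA]) auto
  also have "C (T -` A \<inter> sphere 0 1) = T -` C A"
  proof (rule set_eqI)
    fix x
    have "T x = 0 \<longleftrightarrow> x = 0" using orthogonal_transformation_norm[OF T, of x] by (metis norm_eq_zero)
    then show "x \<in> C (T -` A \<inter> sphere 0 1) \<longleftrightarrow> x \<in> T -` C A"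
      by (cases "x = 0")
        (simp_all add: C_def orthogonal_transformation_norm[OF T] orthogonal_transformation_scaleR[OF T])
  qed
  also have "emeasure lborel (T -` C A) = emeasure lborel (C A)"
    using C_sets[OF A] orthogonal_transformation_borel[OF T]
    by (subst (2) distr_lborel_orthogonal[OF T, symmetric]) (simp add: emeasure_distr)
  also have "of_nat DIM(real^'n) * \<dots> = emeasure sphere_measure A"
    unfolding C_def using A by (rule emeasure_sphere_measure[symmetric])
  finally show "emeasure (distr sphere_measure sphere_measure T) A = emeasure sphere_measure A" .
qed simp

lemma sphere_measure_total:
  "emeasure (sphere_measure :: 'a::euclidean_space measure) (sphere 0 1) =
     ennreal (real DIM('a) * unit_ball_vol (real DIM('a)))"
proof -
  have "emeasure (sphere_measure :: 'a measure) (sphere 0 1) =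
      of_nat DIM('a) * emeasure lborel {x \<in> ball 0 1 - {0::'a}. x /\<^sub>R norm x \<in> sphere 0 1}"
    by (rule emeasure_sphere_measure) auto
  also have "{x \<in> ball 0 1 - {0::'a}. x /\<^sub>R norm x \<in> sphere 0 1} = ball 0 1 - {0}" by auto
  also have "emeasure lborel (ball 0 1 - {0::'a}) = emeasure lborel (ball 0 1 :: 'a set)"
    by (subst emeasure_Diff) auto
  also have "\<dots> = ennreal (unit_ball_vol (real DIM('a)))" by (subst emeasure_ball) auto
  finally show ?thesis by (simp add: ennreal_mult ennreal_of_nat_eq_real_of_nat)
qed

lemma sphere_area_unit_ball_vol:
  "sphere_area TYPE('a::euclidean_space) = real DIM('a) * unit_ball_vol (real DIM('a))"
  by (simp add: sphere_area_def measure_def sphere_measure_total)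

lemma sphere_area_pos: "sphere_area TYPE('a::euclidean_space) > 0"
  by (simp add: sphere_area_unit_ball_vol)

lemma finite_measure_sphere_measure: "finite_measure (sphere_measure :: 'a::euclidean_space measure)"
  by (rule finite_measureI) (simp add: sphere_measure_total)

lemma integrable_continuous_on_sphere:
  fixes f :: "'a::euclidean_space \<Rightarrow> real"
  assumes f: "continuous_on (sphere 0 1) f"
  shows "integrable sphere_measure f"
proof -
  interpret finite_measure "sphere_measure :: 'a measure" by (rule finite_measure_sphere_measure)
  have "bounded (f ` sphere 0 1)" by (intro compact_imp_bounded compact_continuous_image f compact_sphere)
  then obtain B where B: "\<And>x. x \<in> sphere 0 1 \<Longrightarrow> norm (f x) \<le> B" unfolding bounded_iff by blast
  have "f \<in> borel_measurable (restrict_space borel (sphere 0 1))"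
    by (rule borel_measurable_continuous_on_restrict[OF f])
  then have "f \<in> borel_measurable sphere_measure" by (simp cong: measurable_cong_sets)
  then show ?thesis by (intro integrable_const_bound[of _ B] AE_I2) (use B in auto)
qed

lemma integral_sphere_orthogonal:
  fixes T :: "real^'n \<Rightarrow> real^'n" and f :: "real^'n \<Rightarrow> real"
  assumes T: "orthogonal_transformation T" and f: "continuous_on (sphere 0 1) f"
  shows "(\<integral>x. f (T x) \<partial>sphere_measure) = (\<integral>x. f x \<partial>sphere_measure)"
proof -
  have "(\<integral>x. f x \<partial>distr sphere_measure sphere_measure T) = (\<integral>x. f (T x) \<partial>sphere_measure)"
    using integrable_continuous_on_sphere[OF f]
    by (intro integral_distr orthogonal_transformation_measurable_sphere T) auto
  then show ?thesis by (simp add: distr_sphere_measure_orthogonal[OF T])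
qed

lemma integral_sphere_const: "(\<integral>x. c \<partial>(sphere_measure :: 'a::euclidean_space measure)) = c * sphere_area TYPE('a)"
  by (simp add: sphere_area_def)


section \<open>Integrals of zonal polynomials over the sphere\<close>

text \<open>
  The moments of the surface measure in the direction \<open>v\<close> see only the length of \<open>v\<close>. This is
  the form in which rotation invariance determines them.
\<close>

lemma integral_sphere_inner_power_cong:
  fixes v w :: "real^'n"
  assumes "norm v = norm w"
  shows "(\<integral>x. (x \<bullet> v) ^ n \<partial>sphere_measure) = (\<integral>x. (x \<bullet> w) ^ n \<partial>sphere_measure)"
proof -
  obtain T where T: "orthogonal_transformation T" "T v = w"
    using orthogonal_transformation_exists[OF assms] by blast
  have "(\<integral>x. (T x \<bullet> w) ^ n \<partial>sphere_measure) = (\<integral>x. (x \<bullet> w) ^ n \<partial>sphere_measure)"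
    by (rule integral_sphere_orthogonal[OF T(1)]) (intro continuous_intros)
  then show ?thesis using T by (auto simp: orthogonal_transformation_def)
qed

lemma integral_sphere_inner_odd_power:
  fixes a :: "real^'n"
  assumes "odd n"
  shows "(\<integral>x. (x \<bullet> a) ^ n \<partial>sphere_measure) = 0"
proof -
  have "(\<integral>x. (x \<bullet> (- a)) ^ n \<partial>sphere_measure) = (\<integral>x. (x \<bullet> a) ^ n \<partial>sphere_measure)"
    by (rule integral_sphere_inner_power_cong) simp
  then show ?thesis using assms by (simp add: power_minus_odd)
qed

text \<open>
  The moment of order \<open>2 k\<close> in the direction \<open>a + s b\<close> is \<open>(1 + s\<^sup>2) ^ k\<close> times the one in the
  direction \<open>a\<close>. Both sides are polynomials in \<open>s\<close>; the assertion is the equality of the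
  coefficients of \<open>s\<^sup>2\<close>, with the left-hand side expanded by the binomial theorem.
\<close>

lemma integral_sphere_mixed_moment:
  fixes a b :: "real^'n"
  assumes ab: "norm a = 1" "norm b = 1" "a \<bullet> b = 0" and k: "k \<ge> 1"
  shows "real (2 * k - 1) * (\<integral>x. (x \<bullet> a) ^ (2 * k - 2) * (x \<bullet> b)\<^sup>2 \<partial>sphere_measure) =
    (\<integral>x. (x \<bullet> a) ^ (2 * k) \<partial>sphere_measure)"
proof -
  define M where "M j = (\<integral>x. (x \<bullet> b) ^ j * (x \<bullet> a) ^ (2 * k - j) \<partial>sphere_measure)" for j
  define P where "P = (\<Sum>j\<le>2*k. monom (real ((2*k) choose j) * M j) j)"
  define Q where "Q = (\<Sum>i\<le>k. monom (real (k choose i) * M 0) (2*i))"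
  have "poly P s = poly Q s" for s
  proof -
    have "poly P s = (\<Sum>j\<le>2*k. \<integral>x. real ((2*k) choose j) * (s * (x \<bullet> b)) ^ j * (x \<bullet> a) ^ (2*k-j) \<partial>sphere_measure)"
    proof -
      have "real ((2*k) choose j) * M j * s ^ j =
          (\<integral>x. (real ((2*k) choose j) * s ^ j) * ((x \<bullet> b) ^ j * (x \<bullet> a) ^ (2*k-j)) \<partial>sphere_measure)" for j
        by (simp add: M_def)
      then show ?thesis
        unfolding P_def poly_sum poly_monom by (simp only: power_mult_distrib mult_ac)
    qed
    also have "\<dots> = (\<integral>x. (\<Sum>j\<le>2*k. real ((2*k) choose j) * (s * (x \<bullet> b)) ^ j * (x \<bullet> a) ^ (2*k-j)) \<partial>sphere_measure)"
      by (rule Bochner_Integration.integral_sum[symmetric])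
        (intro integrable_continuous_on_sphere continuous_intros)
    also have "\<dots> = (\<integral>x. (x \<bullet> (s *\<^sub>R b + a)) ^ (2*k) \<partial>sphere_measure)"
      by (simp add: inner_add_right binomial_ring)
    also have "\<dots> = (\<integral>x. (x \<bullet> (sqrt (1 + s\<^sup>2) *\<^sub>R a)) ^ (2*k) \<partial>sphere_measure)"
    proof (rule integral_sphere_inner_power_cong)
      have "a \<bullet> a = 1" "b \<bullet> b = 1" using ab by (simp_all add: norm_eq_1)
      then show "norm (s *\<^sub>R b + a) = norm (sqrt (1 + s\<^sup>2) *\<^sub>R a)"
        using ab by (simp add: norm_eq_sqrt_inner inner_add_left inner_add_right inner_commute power2_eq_square)
    qed
    also have "\<dots> = (1 + s\<^sup>2) ^ k * M 0"
      by (simp add: M_def power_mult_distrib power_mult[of "sqrt _"])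
    also have "\<dots> = poly Q s"
      unfolding Q_def poly_sum poly_monom power_mult add.commute[of 1] binomial_ring
      by (simp add: sum_distrib_left sum_distrib_right mult_ac)
    finally show ?thesis .
  qed
  then have "P = Q" by (simp add: poly_eq_poly_eq_iff[symmetric] fun_eq_iff)
  then have "coeff P 2 = coeff Q 2" by simp
  moreover have "coeff P 2 = real ((2*k) choose 2) * M 2"
    using k by (simp add: P_def coeff_sum)
  moreover have "coeff Q 2 = real k * M 0"
  proof -
    have "coeff Q 2 = (\<Sum>i\<le>k. if i = 1 then real (k choose i) * M 0 else 0)"
      unfolding Q_def coeff_sum by (intro sum.cong) auto
    then show ?thesis using k by simp
  qed
  moreover have "real ((2*k) choose 2) = real k * real (2*k-1)"
    using k by (simp add: choose_two)
  ultimately have "real (2*k-1) * M 2 = M 0" using k by simp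
  then show ?thesis by (simp add: M_def mult.commute)
qed

text \<open>
  Sum the mixed moments over the basis vectors \<open>b \<noteq> a\<close>, and use that the squares
  \<open>(x \<bullet> b)\<^sup>2\<close> add up to \<open>1 - (x \<bullet> a)\<^sup>2\<close> on the sphere.
\<close>

lemma integral_sphere_moment_recurrence:
  fixes a :: "real^'n"
  assumes a: "a \<in> Basis"
  shows "real (n + CARD('n)) * (\<integral>x. (x \<bullet> a) ^ (n + 2) \<partial>sphere_measure) =
    real (n + 1) * (\<integral>x. (x \<bullet> a) ^ n \<partial>sphere_measure)"
proof (cases "even n")
  case True
  then obtain k where n: "n = 2 * k" by (elim evenE)
  let ?m = "\<lambda>n. \<integral>x. (x \<bullet> a) ^ n \<partial>(sphere_measure :: (real^'n) measure)"
  have int: "integrable sphere_measure (\<lambda>x::real^'n. (x \<bullet> a) ^ i * (x \<bullet> b) ^ j)" for b i j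
    by (intro integrable_continuous_on_sphere continuous_intros)
  have mixed: "(\<integral>x. (x \<bullet> a) ^ n * (x \<bullet> b)\<^sup>2 \<partial>sphere_measure) * real (n + 1) = ?m (n + 2)"
    if "b \<in> Basis - {a}" for b
  proof -
    have "norm a = 1" "norm b = 1" "a \<bullet> b = 0" using a that by (auto simp: inner_Basis)
    from integral_sphere_mixed_moment[OF this, of "Suc k"] show ?thesis
      by (simp add: n mult.commute)
  qed
  have "?m n - ?m (n + 2) = (\<integral>x. (x \<bullet> a) ^ n - (x \<bullet> a) ^ (n + 2) \<partial>sphere_measure)"
    using int[of n a 0] int[of "n+2" a 0] by simp
  also have "\<dots> = (\<integral>x. (\<Sum>b\<in>Basis - {a}. (x \<bullet> a) ^ n * (x \<bullet> b)\<^sup>2) \<partial>sphere_measure)"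
  proof (rule Bochner_Integration.integral_cong)
    fix x :: "real^'n" assume "x \<in> space sphere_measure"
    then have "1 = x \<bullet> x" by (simp add: norm_eq_1[symmetric])
    also have "\<dots> = (\<Sum>b\<in>Basis. (x \<bullet> b)\<^sup>2)" by (simp add: euclidean_inner[of x x] power2_eq_square)
    also have "\<dots> = (x \<bullet> a)\<^sup>2 + (\<Sum>b\<in>Basis - {a}. (x \<bullet> b)\<^sup>2)" using a by (simp add: sum.remove)
    finally have *: "(\<Sum>b\<in>Basis - {a}. (x \<bullet> b)\<^sup>2) = 1 - (x \<bullet> a)\<^sup>2" by simp
    show "(x \<bullet> a) ^ n - (x \<bullet> a) ^ (n + 2) = (\<Sum>b\<in>Basis - {a}. (x \<bullet> a) ^ n * (x \<bullet> b)\<^sup>2)"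
      unfolding sum_distrib_left[symmetric] * by (simp add: power_add power2_eq_square algebra_simps)
  qed simp
  also have "\<dots> = (\<Sum>b\<in>Basis - {a}. \<integral>x. (x \<bullet> a) ^ n * (x \<bullet> b)\<^sup>2 \<partial>sphere_measure)"
    by (rule Bochner_Integration.integral_sum) (rule int)
  also have "\<dots> * real (n + 1) = (\<Sum>b\<in>Basis - {a}. ?m (n + 2))"
    unfolding sum_distrib_right by (intro sum.cong refl mixed)
  also have "\<dots> = (real CARD('n) - 1) * ?m (n + 2)"
    using a by (simp add: card_Diff_singleton of_nat_diff Suc_le_eq)
  finally show ?thesis by (simp add: algebra_simps)
next
  case False
  then show ?thesis
    using integral_sphere_inner_odd_power[of n a] integral_sphere_inner_odd_power[of "n + 2" a] by (simp del: power_Suc add: add.commute)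
qed

text \<open>
  The moment of order \<open>0\<close>. The weight integrates to a value of the Beta function, and so do the
  volumes of balls in consecutive dimensions.
\<close>

lemma sphere_area_ratio:
  assumes "d \<ge> 2" "CARD('n::finite) = d + 1" "CARD('k::finite) = d"
  shows "((\<lambda>t. sqrt (1 - t\<^sup>2) ^ (d - 2)) has_integral
     sphere_area TYPE(real^'n) / sphere_area TYPE(real^'k)) {-1..1}"
proof -
  have "((\<lambda>t. indicator {-1..1} t * sqrt (1 - t\<^sup>2) ^ (d - 2)) has_integral Beta (1 / 2) (real (d-2) / 2 + 1)) UNIV"
  proof (rule nn_integral_has_integral)
    show "(\<integral>\<^sup>+ x. ennreal (indicat_real {- 1..1} x * sqrt (1 - x\<^sup>2) ^ (d - 2)) \<partial>lborel) =
       ennreal (Beta (1 / 2) (real (d - 2) / 2 + 1))"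
      by (rule emeasure_cball_aux_integral)
    show "0 \<le> Beta (1 / 2) (real (d - 2) / 2 + 1)"
      by (simp add: Beta_def Gamma_real_nonneg)
    show "0 \<le> indicat_real {- 1..1} x * sqrt (1 - x\<^sup>2) ^ (d - 2)" for x
      by (auto simp: indicator_def abs_square_le_1 abs_le_iff)
  qed auto
  then have "((\<lambda>t. sqrt (1 - t\<^sup>2) ^ (d - 2)) has_integral Beta (1 / 2) (real (d-2) / 2 + 1)) {-1..1}"
    by (subst has_integral_restrict_UNIV[symmetric]) (erule has_integral_eq[rotated], simp add: indicator_def)
  also have "Beta (1 / 2) (real (d-2) / 2 + 1) = sphere_area TYPE(real^'n) / sphere_area TYPE(real^'k)"
  proof -
    have area: "sphere_area TYPE(real^'m) = 2 * pi powr (real m / 2) / Gamma (real m / 2)"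
      if "CARD('m::finite) = m" for m
    proof -
      have "m > 0" using that by (metis zero_less_card_finite)
      then have Gamma: "Gamma (real m / 2 + 1) = real m / 2 * Gamma (real m / 2)"
        by (intro Gamma_plus1) (auto simp: nonpos_Ints_def)
      show ?thesis using that \<open>m > 0\<close>
        by (simp add: sphere_area_unit_ball_vol unit_ball_vol_def Gamma)
    qed
    have d: "real (d - 2) / 2 + 1 = real d / 2" using assms(1) by (simp add: field_simps)
    have half: "real (d + 1) / 2 = 1 / 2 + real d / 2" by simp
    have "pi powr (1 / 2 + real d / 2) = sqrt pi * pi powr (real d / 2)"
      by (simp add: powr_add powr_half_sqrt)
    then show ?thesis
      unfolding area[OF assms(2)] area[OF assms(3)] d half Beta_def Gamma_one_half_real by simp
  qed
  finally show ?thesis .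
qed

lemma gegenbauer_weight_integrable:
  fixes f :: "real \<Rightarrow> real"
  assumes "continuous_on {-1..1} f"
  shows "(\<lambda>t. f t * sqrt (1 - t\<^sup>2) ^ m) integrable_on {-1..1}"
  by (intro integrable_continuous_interval continuous_intros assms)

text \<open>
  The moments of the weight on \<open>[-1, 1]\<close> satisfy the same recurrence as those of the sphere:
  integrate the derivative of \<open>t ^ (n + 1) * (1 - t\<^sup>2) powr (d / 2)\<close>, which vanishes at both ends.
\<close>

lemma gegenbauer_weight_moment_recurrence:
  assumes d: "d \<ge> 2"
  shows "real (n + d + 1) * integral {-1..1} (\<lambda>t. t ^ (n + 2) * sqrt (1 - t\<^sup>2) ^ (d - 2)) =
    real (n + 1) * integral {-1..1} (\<lambda>t. t ^ n * sqrt (1 - t\<^sup>2) ^ (d - 2))"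
proof -
  let ?w = "\<lambda>t::real. sqrt (1 - t\<^sup>2) ^ (d - 2)"
  let ?f = "\<lambda>t. real (n + 1) * (t ^ n * ?w t) - real (n + d + 1) * (t ^ (n + 2) * ?w t)"
  have deriv: "((\<lambda>t. t ^ (n + 1) * sqrt (1 - t\<^sup>2) ^ d) has_vector_derivative ?f t) (at t)"
    if t: "t \<in> {-1<..<1}" for t
  proof -
    have "t\<^sup>2 < 1" using t by (simp add: abs_square_less_1 abs_less_iff)
    define r where "r = sqrt (1 - t\<^sup>2)"
    have r: "r > 0" "r\<^sup>2 = 1 - t\<^sup>2" using \<open>t\<^sup>2 < 1\<close> by (simp_all add: r_def)
    have "((\<lambda>t. sqrt (1 - t\<^sup>2)) has_real_derivative - t / r) (at t)"
      using \<open>t\<^sup>2 < 1\<close> unfolding r_def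
      by (auto intro!: derivative_eq_intros simp: field_simps)
    from DERIV_mult[OF DERIV_pow[of "n + 1" t] DERIV_power[OF this, of d]]
    have "((\<lambda>t. t ^ (n + 1) * sqrt (1 - t\<^sup>2) ^ d) has_real_derivative
        real (n + 1) * t ^ n * r ^ d + t ^ (n + 1) * (real d * r ^ (d - 1) * (- t / r))) (at t)"
      by (simp add: r_def mult_ac)
    also have "r ^ d = r ^ (d - 2) * r\<^sup>2" using d by (metis le_add_diff_inverse2 power_add)
    also have "r ^ (d - 1) = r ^ (d - 2) * r" using d by (metis Suc_diff_Suc Suc_1 Suc_le_lessD power_Suc2)
    also have "real (n + 1) * t ^ n * (r ^ (d - 2) * r\<^sup>2) + t ^ (n + 1) * (real d * (r ^ (d - 2) * r) * (- t / r)) = ?f t"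
      using r(1) unfolding r(2) unfolding r_def by (simp add: algebra_simps power2_eq_square)
    finally show ?thesis by (simp add: has_real_derivative_iff_has_vector_derivative)
  qed
  have "(?f has_integral (1 ^ (n + 1) * sqrt (1 - 1\<^sup>2) ^ d - (-1) ^ (n + 1) * sqrt (1 - (-1)\<^sup>2) ^ d)) {-1..1::real}"
    by (rule fundamental_theorem_of_calculus_interior) (use deriv in \<open>auto intro!: continuous_intros simp del: power_Suc power_add_numeral add_2_eq_Suc'\<close>)
  then have "integral {-1..1} ?f = 0" using d by (simp add: integral_unique power_0_left)
  also have "integral {-1..1} ?f = real (n + 1) * integral {-1..1} (\<lambda>t. t ^ n * ?w t) -
      real (n + d + 1) * integral {-1..1} (\<lambda>t. t ^ (n + 2) * ?w t)"
    by (subst Henstock_Kurzweil_Integration.integral_diff)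
      (auto intro!: integrable_on_mult_right gegenbauer_weight_integrable continuous_intros)
  finally show ?thesis by simp
qed

lemma gegenbauer_weight_odd_moment:
  assumes "odd n"
  shows "integral {-1..1} (\<lambda>t::real. t ^ n * sqrt (1 - t\<^sup>2) ^ m) = 0"
proof -
  let ?f = "\<lambda>t::real. t ^ n * sqrt (1 - t\<^sup>2) ^ m"
  have "integral {-1..1} ?f = integral {- 1..- (- 1)} (\<lambda>t. ?f (- t))"
    by (rule Henstock_Kurzweil_Integration.integral_reflect_real[where a = "- 1" and b = 1 and f = ?f, symmetric])
  also have "\<dots> = - integral {-1..1} ?f"
    using assms by (simp add: power_minus_odd del: integral_reflect_real)
  finally show ?thesis by simp
qed

lemma integral_sphere_inner_power:
  fixes a :: "real^'n"
  assumes a: "a \<in> Basis" and d: "d \<ge> 2" "CARD('n) = d + 1" "CARD('k::finite) = d"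
  shows "(\<integral>x. (x \<bullet> a) ^ n \<partial>sphere_measure) =
    sphere_area TYPE(real^'k) * integral {-1..1} (\<lambda>t. t ^ n * sqrt (1 - t\<^sup>2) ^ (d - 2))"
proof (induction n rule: induct_nat_012)
  case 0
  have "integral {-1..1} (\<lambda>t. sqrt (1 - t\<^sup>2) ^ (d - 2)) =
      sphere_area TYPE(real^'n) / sphere_area TYPE(real^'k)"
    by (rule integral_unique[OF sphere_area_ratio[OF d]])
  then show ?case
    using sphere_area_pos[where 'a = "real^'k"] by (simp add: integral_sphere_const[of 1, simplified])
next
  case 1
  show ?case by (simp add: integral_sphere_inner_odd_power[of 1, simplified] gegenbauer_weight_odd_moment[of 1, simplified])
next
  case (ge2 n)
  let ?L = "\<integral>x. (x \<bullet> a) ^ (n + 2) \<partial>sphere_measure"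
  let ?J = "\<lambda>n. integral {-1..1} (\<lambda>t. t ^ n * sqrt (1 - t\<^sup>2) ^ (d - 2))"
  have "real (n + d + 1) * ?L = real (n + 1) * (\<integral>x. (x \<bullet> a) ^ n \<partial>sphere_measure)"
    using integral_sphere_moment_recurrence[OF a, of n] d(2) by (simp add: add_ac)
  also have "\<dots> = sphere_area TYPE(real^'k) * (real (n + 1) * ?J n)"
    by (simp add: ge2.IH(1))
  also have "\<dots> = real (n + d + 1) * (sphere_area TYPE(real^'k) * ?J (n + 2))"
    using gegenbauer_weight_moment_recurrence[OF d(1), of n] by simp
  finally have "?L = sphere_area TYPE(real^'k) * ?J (n + 2)"
    by (subst (asm) mult_left_cancel) auto
  then show ?case by simp
qed

text \<open>
  The slice formula for the sphere, for polynomials. By linearity it reduces to powers of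
  \<open>x \<bullet> a\<close>, where both sides obey the same recurrence.
\<close>

theorem integral_sphere_zonal:
  fixes a :: "real^'n"
  assumes "a \<in> Basis" "d \<ge> 2" "CARD('n) = d + 1" "CARD('k::finite) = d"
  shows "(\<integral>x. poly p (x \<bullet> a) \<partial>sphere_measure) =
    sphere_area TYPE(real^'k) * integral {-1..1} (\<lambda>t. poly p t * sqrt (1 - t\<^sup>2) ^ (d - 2))"
proof -
  let ?w = "\<lambda>t::real. sqrt (1 - t\<^sup>2) ^ (d - 2)"
  have "(\<integral>x. poly p (x \<bullet> a) \<partial>sphere_measure) =
      (\<Sum>i\<le>degree p. coeff p i * (\<integral>x. (x \<bullet> a) ^ i \<partial>sphere_measure))"
    unfolding poly_altdef
    by (subst Bochner_Integration.integral_sum)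
      (auto intro!: integrable_continuous_on_sphere continuous_intros)
  also have "\<dots> = sphere_area TYPE(real^'k) *
      (\<Sum>i\<le>degree p. integral {-1..1} (\<lambda>t. coeff p i * (t ^ i * ?w t)))"
    by (simp add: integral_sphere_inner_power[OF assms] sum_distrib_left mult_ac)
  also have "(\<Sum>i\<le>degree p. integral {-1..1} (\<lambda>t. coeff p i * (t ^ i * ?w t))) =
      integral {-1..1} (\<lambda>t. \<Sum>i\<le>degree p. coeff p i * (t ^ i * ?w t))"
    by (rule Henstock_Kurzweil_Integration.integral_sum[symmetric])
      (auto intro!: integrable_on_mult_right gegenbauer_weight_integrable continuous_intros)
  finally show ?thesis by (simp add: poly_altdef sum_distrib_right mult_ac)
qed

section \<open>Second derivatives and the eigenspaces of the Laplace-Beltrami operator\<close>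

text \<open>
  \<open>C2_on\<close> with its witnesses named, so that \<open>f''\<close> can be used as the Hessian of \<open>f\<close>.
\<close>

definition C2_derivs ::
    "'a::real_normed_vector set \<Rightarrow> ('a \<Rightarrow> real) \<Rightarrow> ('a \<Rightarrow> 'a \<Rightarrow>\<^sub>L real) \<Rightarrow>
     ('a \<Rightarrow> 'a \<Rightarrow>\<^sub>L 'a \<Rightarrow>\<^sub>L real) \<Rightarrow> bool" where
  "C2_derivs U f f' f'' \<longleftrightarrow>
     (\<forall>x\<in>U. (f has_derivative blinfun_apply (f' x)) (at x)) \<and>
     (\<forall>x\<in>U. (f' has_derivative blinfun_apply (f'' x)) (at x)) \<and>
     continuous_on U f''"

lemma C2_on_iff: "C2_on U f \<longleftrightarrow> (\<exists>f' f''. C2_derivs U f f' f'')"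
  by (simp add: C2_on_def C2_derivs_def)

text \<open>
  The chain rule to second order, with \<open>v\<close> the velocity and \<open>w\<close> the acceleration of the curve.
\<close>

lemma C2_derivs_along_curve:
  assumes f: "C2_derivs U f f' f''" and U: "c t \<in> U"
    and c: "(c has_vector_derivative v t) (at t)"
  shows "((\<lambda>s. f (c s)) has_real_derivative f' (c t) (v t)) (at t)"
    and "(v has_vector_derivative w) (at t) \<Longrightarrow>
      ((\<lambda>s. f' (c s) (v s)) has_real_derivative f'' (c t) (v t) (v t) + f' (c t) w) (at t)"
proof -
  have c': "(c has_derivative (\<lambda>h. h *\<^sub>R v t)) (at t)"
    using c by (simp add: has_vector_derivative_def)
  have "(f has_derivative f' (c t)) (at (c t))" using f U by (simp add: C2_derivs_def)
  from has_derivative_compose[OF c' this]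
  show "((\<lambda>s. f (c s)) has_real_derivative f' (c t) (v t)) (at t)"
    by (simp add: has_field_derivative_def blinfun.scaleR_right mult_commute_abs)
  assume v: "(v has_vector_derivative w) (at t)"
  then have dv: "(v has_derivative (\<lambda>h. h *\<^sub>R w)) (at t)"
    by (simp add: has_vector_derivative_def)
  have "(f' has_derivative f'' (c t)) (at (c t))" using f U by (simp add: C2_derivs_def)
  from has_derivative_compose[OF c' this]
  have "((\<lambda>s. f' (c s)) has_derivative (\<lambda>h. f'' (c t) (h *\<^sub>R v t))) (at t)" .
  from blinfun.FDERIV[OF this dv]
  show "((\<lambda>s. f' (c s) (v s)) has_real_derivative f'' (c t) (v t) (v t) + f' (c t) w) (at t)"
    by (simp add: has_field_derivative_def blinfun.scaleR_right blinfun.scaleR_left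
        distrib_left[symmetric] mult_commute_abs add.commute)
qed

lemma laplacian_eq_trace:
  fixes f :: "'a::euclidean_space \<Rightarrow> real"
  assumes f: "C2_derivs U f f' f''" and U: "open U" "x \<in> U"
  shows "laplacian f x = (\<Sum>b\<in>Basis. f'' x b b)"
  unfolding laplacian_def
proof (rule sum.cong[OF refl])
  fix b :: 'a
  let ?c = "\<lambda>t. x + t *\<^sub>R b"
  have c: "(?c has_vector_derivative b) (at t)" for t
    by (auto intro!: derivative_eq_intros simp: has_vector_derivative_def)
  have "open (?c -` U)" using U by (intro open_vimage continuous_intros)
  have d1: "deriv (\<lambda>t. f (?c t)) t = f' (?c t) b" if "t \<in> ?c -` U" for t
    by (rule DERIV_imp_deriv, rule C2_derivs_along_curve(1)[OF f, where c = ?c and v = "\<lambda>_. b"]) (use that c in auto)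
  have "((\<lambda>t. f' (?c t) b) has_real_derivative f'' x b b) (at 0)"
    using C2_derivs_along_curve(2)[OF f, of ?c 0 "\<lambda>_. b" 0] U c by simp
  then have "(deriv (\<lambda>t. f (?c t)) has_real_derivative f'' x b b) (at 0)"
    by (rule has_field_derivative_transform_within_open[OF _ \<open>open (?c -` U)\<close>]) (use U d1 in auto)
  then show "deriv (deriv (\<lambda>t. f (?c t))) 0 = f'' x b b" by (rule DERIV_imp_deriv)
qed

lemma C2_derivs_sum:
  assumes "\<And>i. i \<in> I \<Longrightarrow> C2_derivs U (f i) (f' i) (f'' i)"
  shows "C2_derivs U (\<lambda>x. \<Sum>i\<in>I. c i * f i x) (\<lambda>x. \<Sum>i\<in>I. c i *\<^sub>R f' i x)
    (\<lambda>x. \<Sum>i\<in>I. c i *\<^sub>R f'' i x)"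
  unfolding C2_derivs_def
proof (intro conjI ballI)
  fix x assume x: "x \<in> U"
  have "((\<lambda>x. \<Sum>i\<in>I. c i * f i x) has_derivative (\<lambda>h. \<Sum>i\<in>I. c i * f' i x h)) (at x)"
    by (intro has_derivative_sum has_derivative_mult_right) (use assms x in \<open>simp add: C2_derivs_def\<close>)
  moreover have "blinfun_apply (\<Sum>i\<in>I. c i *\<^sub>R f' i x) = (\<lambda>h. \<Sum>i\<in>I. c i * f' i x h)"
    by (rule ext) (simp add: blinfun.sum_left blinfun.scaleR_left)
  ultimately show "((\<lambda>x. \<Sum>i\<in>I. c i * f i x) has_derivative (\<Sum>i\<in>I. c i *\<^sub>R f' i x)) (at x)"
    by simp
  have "((\<lambda>x. \<Sum>i\<in>I. c i *\<^sub>R f' i x) has_derivative (\<lambda>h. \<Sum>i\<in>I. c i *\<^sub>R f'' i x h)) (at x)"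
    by (intro has_derivative_sum has_derivative_scaleR_right) (use assms x in \<open>simp add: C2_derivs_def\<close>)
  moreover have "blinfun_apply (\<Sum>i\<in>I. c i *\<^sub>R f'' i x) = (\<lambda>h. \<Sum>i\<in>I. c i *\<^sub>R f'' i x h)"
    by (rule ext) (simp add: blinfun.sum_left blinfun.scaleR_left)
  ultimately show "((\<lambda>x. \<Sum>i\<in>I. c i *\<^sub>R f' i x) has_derivative (\<Sum>i\<in>I. c i *\<^sub>R f'' i x)) (at x)"
    by simp
next
  show "continuous_on U (\<lambda>x. \<Sum>i\<in>I. c i *\<^sub>R f'' i x)"
    by (intro continuous_intros) (use assms in \<open>simp add: C2_derivs_def\<close>)
qed

lemma eigenspaceE:
  assumes "f \<in> laplace_beltrami_eigenspace c"
  obtains F' F'' where "C2_derivs (- {0}) (radial_extension f) F' F''"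
    "\<And>x. norm x = 1 \<Longrightarrow> (\<Sum>b\<in>Basis. F'' x b b) = c * f x"
proof -
  obtain F' F'' where F: "C2_derivs (- {0}) (radial_extension f) F' F''"
    using assms by (auto simp: laplace_beltrami_eigenspace_def C2_on_iff)
  have "(\<Sum>b\<in>Basis. F'' x b b) = c * f x" if "norm x = 1" for x
  proof -
    have "x \<in> - {0}" using that by auto
    from laplacian_eq_trace[OF F _ this] show ?thesis
      using assms that by (simp add: laplace_beltrami_eigenspace_def laplace_beltrami_def open_Compl)
  qed
  with F show ?thesis by (rule that)
qed

lemma eigenspaceI:
  assumes F: "C2_derivs (- {0}) (radial_extension f) F' F''"
    and "\<And>x. norm x = 1 \<Longrightarrow> (\<Sum>b\<in>Basis. F'' x b b) = c * f x"
  shows "f \<in> laplace_beltrami_eigenspace c"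
proof -
  have "laplace_beltrami f x = c * f x" if "norm x = 1" for x
  proof -
    have "x \<in> - {0}" using that by auto
    from laplacian_eq_trace[OF F _ this] show ?thesis
      using assms(2)[OF that] by (simp add: laplace_beltrami_def open_Compl)
  qed
  then show ?thesis using F by (auto simp: laplace_beltrami_eigenspace_def C2_on_iff)
qed

lemma eigenspace_linear_combination:
  fixes f :: "'i \<Rightarrow> 'a::euclidean_space \<Rightarrow> real"
  assumes "\<And>i. i \<in> I \<Longrightarrow> f i \<in> laplace_beltrami_eigenspace c"
  shows "(\<lambda>x. \<Sum>i\<in>I. k i * f i x) \<in> laplace_beltrami_eigenspace c"
proof -
  have "\<forall>i\<in>I. \<exists>F' F''. C2_derivs (- {0}) (radial_extension (f i)) F' F'' \<and>
      (\<forall>x. norm x = 1 \<longrightarrow> (\<Sum>b\<in>Basis. F'' x b b) = c * f i x)"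
    using eigenspaceE[OF assms] by blast
  from bchoice[OF this] obtain F' where "\<forall>i\<in>I. \<exists>F''. C2_derivs (- {0}) (radial_extension (f i)) (F' i) F'' \<and>
      (\<forall>x. norm x = 1 \<longrightarrow> (\<Sum>b\<in>Basis. F'' x b b) = c * f i x)" by blast
  from bchoice[OF this] obtain F'' where
      F: "\<And>i. i \<in> I \<Longrightarrow> C2_derivs (- {0}) (radial_extension (f i)) (F' i) (F'' i)"
        "\<And>i x. i \<in> I \<Longrightarrow> norm x = 1 \<Longrightarrow> (\<Sum>b\<in>Basis. F'' i x b b) = c * f i x"
    by blast
  have "radial_extension (\<lambda>x. \<Sum>i\<in>I. k i * f i x) = (\<lambda>x. \<Sum>i\<in>I. k i * radial_extension (f i) x)"
    by (simp add: radial_extension_def fun_eq_iff)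
  with C2_derivs_sum[where I = I and c = k, OF F(1)]
  have "C2_derivs (- {0}) (radial_extension (\<lambda>x. \<Sum>i\<in>I. k i * f i x))
      (\<lambda>x. \<Sum>i\<in>I. k i *\<^sub>R F' i x) (\<lambda>x. \<Sum>i\<in>I. k i *\<^sub>R F'' i x)" by simp
  then show ?thesis
  proof (rule eigenspaceI)
    fix x :: 'a assume "norm x = 1"
    then have "c * (\<Sum>i\<in>I. k i * f i x) = (\<Sum>i\<in>I. k i * (\<Sum>b\<in>Basis. F'' i x b b))"
      by (simp add: F(2) sum_distrib_left mult_ac)
    also have "\<dots> = (\<Sum>b\<in>Basis. \<Sum>i\<in>I. k i * F'' i x b b)"
      unfolding sum_distrib_left by (rule sum.swap)
    finally show "(\<Sum>b\<in>Basis. (\<Sum>i\<in>I. k i *\<^sub>R F'' i x) b b) = c * (\<Sum>i\<in>I. k i * f i x)"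
      by (simp add: blinfun.sum_left blinfun.scaleR_left)
  qed
qed

text \<open>
  The trace of a bilinear form is the same in every orthonormal basis; this is what makes the
  Laplacian commute with orthogonal maps.
\<close>

lemma trace_orthogonal_transformation:
  fixes H :: "'a::euclidean_space \<Rightarrow>\<^sub>L 'a \<Rightarrow>\<^sub>L real" and T :: "'a \<Rightarrow> 'a"
  assumes T: "orthogonal_transformation T"
  shows "(\<Sum>b\<in>Basis. H (T b) (T b)) = (\<Sum>b\<in>Basis. H b b)"
proof -
  have expand: "H u u = (\<Sum>c\<in>Basis. \<Sum>e\<in>Basis. ((u \<bullet> c) * (u \<bullet> e)) * H c e)" for u
  proof -
    have "H u u = H (\<Sum>c\<in>Basis. (u \<bullet> c) *\<^sub>R c) (\<Sum>e\<in>Basis. (u \<bullet> e) *\<^sub>R e)"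
      by (simp only: euclidean_representation)
    also have "\<dots> = (\<Sum>c\<in>Basis. \<Sum>e\<in>Basis. ((u \<bullet> c) * (u \<bullet> e)) * H c e)"
      unfolding blinfun.sum_right blinfun.sum_left blinfun.scaleR_right blinfun.scaleR_left
      by (subst sum.swap) (simp add: sum_distrib_left mult_ac)
    finally show ?thesis .
  qed
  have orth: "(\<Sum>b\<in>Basis. (T b \<bullet> c) * (T b \<bullet> e)) = (if c = e then 1 else 0)"
    if "c \<in> Basis" "e \<in> Basis" for c e
  proof -
    have "T b \<bullet> v = inv T v \<bullet> b" for b v
      using T orthogonal_transformation_surj[OF T]
      by (metis inner_commute orthogonal_transformation_def surj_f_inv_f)
    then have "(\<Sum>b\<in>Basis. (T b \<bullet> c) * (T b \<bullet> e)) = inv T c \<bullet> inv T e"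
      by (simp add: euclidean_inner[of "inv T c" "inv T e"])
    also have "\<dots> = c \<bullet> e"
      using orthogonal_transformation_inv[OF T] by (simp add: orthogonal_transformation_def)
    finally show ?thesis using that by (simp add: inner_Basis)
  qed
  have "(\<Sum>b\<in>Basis. H (T b) (T b)) =
      (\<Sum>c\<in>Basis. \<Sum>e\<in>Basis. (\<Sum>b\<in>Basis. (T b \<bullet> c) * (T b \<bullet> e)) * H c e)"
    unfolding expand[of "T _"] sum_distrib_right
    by (subst sum.swap, rule sum.cong[OF refl], rule sum.swap)
  also have "\<dots> = (\<Sum>c\<in>Basis. \<Sum>e\<in>Basis. if c = e then H c e else 0)"
    by (intro sum.cong refl) (simp add: orth)
  finally show ?thesis by simp
qed

lemma C2_derivs_compose_linear:
  fixes T :: "'a::euclidean_space \<Rightarrow> 'a"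
  assumes T: "linear T" and TU: "\<And>x. x \<in> U \<Longrightarrow> T x \<in> U" and f: "C2_derivs U f f' f''"
  obtains F' F'' where "C2_derivs U (\<lambda>x. f (T x)) F' F''"
    "\<And>x u v. F'' x u v = f'' (T x) (T u) (T v)"
proof -
  define B where "B = Blinfun T"
  have B: "blinfun_apply B = T"
    unfolding B_def using T by (simp add: bounded_linear_Blinfun_apply linear_conv_bounded_linear)
  define R where "R = Blinfun (\<lambda>A :: 'a \<Rightarrow>\<^sub>L real. A o\<^sub>L B)"
  have R: "blinfun_apply R A = A o\<^sub>L B" for A
    unfolding R_def by (simp add: bounded_linear_Blinfun_apply bounded_bilinear.bounded_linear_left[OF bounded_bilinear_blinfun_compose])
  define F' where "F' = (\<lambda>x. R (f' (T x)))"
  define F'' where "F'' = (\<lambda>x. R o\<^sub>L (f'' (T x) o\<^sub>L B))"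
  have dT: "(T has_derivative T) (at x)" for x
    by (rule linear_imp_has_derivative[OF T])
  have "C2_derivs U (\<lambda>x. f (T x)) F' F''"
    unfolding C2_derivs_def
  proof (intro conjI ballI)
    fix x assume x: "x \<in> U"
    have "blinfun_apply (F' x) = (\<lambda>h. f' (T x) (T h))"
      by (rule ext) (simp add: F'_def R B)
    then show "((\<lambda>x. f (T x)) has_derivative F' x) (at x)"
      using has_derivative_compose[OF dT, of f "f' (T x)" x] f TU[OF x]
      by (simp add: C2_derivs_def)
    have "((\<lambda>x. f' (T x)) has_derivative (\<lambda>h. f'' (T x) (T h))) (at x)"
      using has_derivative_compose[OF dT, of f' "f'' (T x)" x] f TU[OF x] by (simp add: C2_derivs_def)
    from bounded_linear.has_derivative[OF blinfun.bounded_linear_right this]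
    have "(F' has_derivative (\<lambda>h. R (f'' (T x) (T h)))) (at x)" unfolding F'_def .
    moreover have "blinfun_apply (F'' x) = (\<lambda>h. R (f'' (T x) (T h)))"
      by (rule ext) (simp add: F''_def B)
    ultimately show "(F' has_derivative F'' x) (at x)" by simp
  next
    have "continuous_on U f''" using f by (simp add: C2_derivs_def)
    moreover have "continuous_on U T"
      using T by (intro linear_continuous_on) (simp add: linear_conv_bounded_linear)
    ultimately have "continuous_on U (\<lambda>x. f'' (T x))"
      by (rule continuous_on_compose2) (use TU in auto)
    then show "continuous_on U F''" unfolding F''_def
      by (intro bounded_bilinear.continuous_on[OF bounded_bilinear_blinfun_compose] continuous_on_const)
  qed
  moreover have "F'' x u v = f'' (T x) (T u) (T v)" for x u v
    by (simp add: F''_def R B)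
  ultimately show ?thesis by (rule that)
qed

theorem eigenspace_orthogonal_transformation:
  fixes T :: "'a::euclidean_space \<Rightarrow> 'a"
  assumes T: "orthogonal_transformation T" and f: "f \<in> laplace_beltrami_eigenspace c"
  shows "(\<lambda>x. f (T x)) \<in> laplace_beltrami_eigenspace c"
proof -
  obtain F' F'' where F: "C2_derivs (- {0}) (radial_extension f) F' F''"
    "\<And>x. norm x = 1 \<Longrightarrow> (\<Sum>b\<in>Basis. F'' x b b) = c * f x" using f by (rule eigenspaceE) blast
  have "T x \<in> - {0}" if "x \<in> - {0}" for x
    using that orthogonal_transformation_norm[OF T, of x] by auto
  then obtain G' G'' where G: "C2_derivs (- {0}) (\<lambda>x. radial_extension f (T x)) G' G''"
    "\<And>x u v. G'' x u v = F'' (T x) (T u) (T v)"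
    using C2_derivs_compose_linear[OF orthogonal_transformation_linear[OF T] _ F(1)] by metis
  have "radial_extension (\<lambda>x. f (T x)) = (\<lambda>x. radial_extension f (T x))"
    using T by (simp add: radial_extension_def fun_eq_iff orthogonal_transformation_norm orthogonal_transformation_scaleR)
  with G(1) have "C2_derivs (- {0}) (radial_extension (\<lambda>x. f (T x))) G' G''" by simp
  then show ?thesis
    by (rule eigenspaceI)
      (simp add: G(2) trace_orthogonal_transformation[OF T] F(2) orthogonal_transformation_norm[OF T])
qed

lemma eigenspace_continuous_on:
  assumes "f \<in> laplace_beltrami_eigenspace c"
  shows "continuous_on (sphere 0 1) f"
proof -
  obtain F' F'' where F: "C2_derivs (- {0}) (radial_extension f) F' F''" using assms by (rule eigenspaceE)
  have cont: "isCont (radial_extension f) x" if "x \<noteq> 0" for x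
    using F that by (auto simp: C2_derivs_def intro: has_derivative_continuous)
  have "continuous_on (sphere 0 1) (radial_extension f)"
    by (intro continuous_at_imp_continuous_on ballI cont) auto
  then show ?thesis by (rule continuous_on_eq) (simp add: radial_extension_def)
qed

section \<open>The differential equation of the Gegenbauer polynomials\<close>

text \<open>
  The coefficients of the Gegenbauer polynomial in powers of \<open>(t - 1) / 2\<close>, the variable in which
  it is hypergeometric.
\<close>

definition gegenbauer_coeff :: "nat \<Rightarrow> nat \<Rightarrow> nat \<Rightarrow> real" where
  "gegenbauer_coeff l d k =
     inverse ((real l + real d / 2 - 1) gchoose l) *
     (real (l choose k) * pochhammer (real l + real d - 1) k *
        pochhammer (real d / 2 + real k) (l - k)) / fact l"

lemma gegenbauer_coeff_recurrence:
  "real (k + 1) * (real k + real d / 2) * gegenbauer_coeff l d (k + 1) =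
     (real l * (real l + real d - 1) - real k * (real k + real d - 1)) * gegenbauer_coeff l d k"
proof -
  consider "k < l" | "k = l" | "k > l" by linarith
  then show ?thesis
  proof cases
    case 1
    then obtain m where m: "l = Suc (k + m)" using less_imp_Suc_add by blast
    have P: "pochhammer (real d / 2 + real k) (l - k) =
        (real k + real d / 2) * pochhammer (real d / 2 + real (k + 1)) (l - (k + 1))"
      by (simp add: m pochhammer_rec add_ac)
    have "Suc k * (l choose Suc k) = (l - k) * (l choose k)"
      using binomial_absorb_comp[of l k] binomial_absorption[of k l]
      by (metis binomial_absorb_comp binomial_absorption)
    then have C: "real (k + 1) * real (l choose (k + 1)) = (real l - real k) * real (l choose k)"
      using 1 by (metis Suc_eq_plus1 of_nat_diff of_nat_mult less_imp_le)
    have "real (k + 1) * (real k + real d / 2) * gegenbauer_coeff l d (k + 1) =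
        inverse ((real l + real d / 2 - 1) gchoose l) *
        (real (k + 1) * real (l choose (k + 1))) * pochhammer (real l + real d - 1) (k + 1) *
        ((real k + real d / 2) * pochhammer (real d / 2 + real (k + 1)) (l - (k + 1))) / fact l"
      by (simp only: gegenbauer_coeff_def times_divide_eq_right mult_ac)
    also have "\<dots> = inverse ((real l + real d / 2 - 1) gchoose l) *
        ((real l - real k) * real (l choose k)) *
        (pochhammer (real l + real d - 1) k * (real l + real d - 1 + real k)) *
        pochhammer (real d / 2 + real k) (l - k) / fact l"
      unfolding P[symmetric] C by (simp add: pochhammer_Suc)
    also have "\<dots> = ((real l - real k) * (real l + real d - 1 + real k)) * gegenbauer_coeff l d k"
      by (simp only: gegenbauer_coeff_def times_divide_eq_right mult_ac)
    also have "(real l - real k) * (real l + real d - 1 + real k) =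
        real l * (real l + real d - 1) - real k * (real k + real d - 1)"
      by (simp add: algebra_simps)
    finally show ?thesis .
  qed (simp_all add: gegenbauer_coeff_def binomial_eq_0)
qed

definition gegenbauer_shifted_poly :: "nat \<Rightarrow> nat \<Rightarrow> real poly" where
  "gegenbauer_shifted_poly l d = (\<Sum>k\<le>l. monom (gegenbauer_coeff l d k) k)"

lemma gegenbauer_eq_poly: "gegenbauer l d t = poly (gegenbauer_shifted_poly l d) ((t - 1) / 2)"
proof -
  have *: "real l + (real d / 2 - 1) + (real d / 2 - 1) + 1 = real l + real d - 1"
    "real d / 2 - 1 + real k + 1 = real d / 2 + real k" for k by simp_all
  show ?thesis
    unfolding gegenbauer_def jacobi_poly_def gegenbauer_shifted_poly_def poly_sum poly_monom * gegenbauer_coeff_def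
    by (simp add: sum_distrib_left sum_divide_distrib mult_ac)
qed

text \<open>
  With \<open>t = 2 s + 1\<close> this is the Gegenbauer equation
  \<open>(1 - t\<^sup>2) G'' - d t G' + l (l + d - 1) G = 0\<close>. Comparing coefficients turns it into
  \<open>gegenbauer_coeff_recurrence\<close>.
\<close>

lemma gegenbauer_hypergeometric_ode:
  fixes s :: real and l d :: nat
  defines "q \<equiv> gegenbauer_shifted_poly l d"
  shows "s * (s + 1) * poly (pderiv (pderiv q)) s + real d / 2 * (2 * s + 1) * poly (pderiv q) s =
    real l * (real l + real d - 1) * poly q s"
proof -
  define \<kappa> where "\<kappa> = real l * (real l + real d - 1)"
  have q: "coeff q k = gegenbauer_coeff l d k" for k
    by (simp add: q_def gegenbauer_shifted_poly_def coeff_sum) (simp add: gegenbauer_coeff_def)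
  have rec: "real (k + 1) * (real k + real d / 2) * coeff q (k + 1) =
      (\<kappa> - real k * (real k + real d - 1)) * coeff q k" for k
    unfolding q \<kappa>_def by (rule gegenbauer_coeff_recurrence)
  have "[:0, 1, 1:] * pderiv (pderiv q) + smult (real d / 2) ([:1, 2:] * pderiv q) = smult \<kappa> q"
  proof (rule poly_eqI)
    fix k
    show "coeff ([:0, 1, 1:] * pderiv (pderiv q) + smult (real d / 2) ([:1, 2:] * pderiv q)) k =
        coeff (smult \<kappa> q) k"
      using rec[of k]
      by (cases k; cases "k - 1") (simp_all add: coeff_pderiv coeff_pCons algebra_simps add_divide_distrib)
  qed
  then have "poly ([:0, 1, 1:] * pderiv (pderiv q) + smult (real d / 2) ([:1, 2:] * pderiv q)) s =
      poly (smult \<kappa> q) s" by simp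
  then show ?thesis by (simp add: \<kappa>_def algebra_simps)
qed

text \<open>
  In the polar angle the equation takes the form satisfied by a zonal eigenfunction along a
  meridian.
\<close>

lemma gegenbauer_cos_ode:
  obtains v' v'' :: "real \<Rightarrow> real" where
    "\<And>\<theta>. ((\<lambda>\<theta>. gegenbauer l d (cos \<theta>)) has_real_derivative v' \<theta>) (at \<theta>)"
    "\<And>\<theta>. (v' has_real_derivative v'' \<theta>) (at \<theta>)"
    "v' 0 = 0"
    "\<And>\<theta>. sin \<theta> * v'' \<theta> + (real d - 1) * cos \<theta> * v' \<theta> +
       real l * (real l + real d - 1) * sin \<theta> * gegenbauer l d (cos \<theta>) = 0"
proof -
  define q where "q = gegenbauer_shifted_poly l d"
  define s where "s \<theta> = (cos \<theta> - 1) / 2" for \<theta> :: real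
  define v' where "v' = (\<lambda>\<theta>. - (sin \<theta> / 2) * poly (pderiv q) (s \<theta>))"
  define v'' where "v'' = (\<lambda>\<theta>. (sin \<theta>)\<^sup>2 / 4 * poly (pderiv (pderiv q)) (s \<theta>) -
      cos \<theta> / 2 * poly (pderiv q) (s \<theta>))"
  have s: "(s has_real_derivative - (sin \<theta> / 2)) (at \<theta>)" for \<theta>
    unfolding s_def by (auto intro!: derivative_eq_intros)
  have chain: "((\<lambda>\<theta>. poly p (s \<theta>)) has_real_derivative poly (pderiv p) (s \<theta>) * - (sin \<theta> / 2)) (at \<theta>)" for p \<theta>
    by (rule DERIV_chain2[OF poly_DERIV s])
  have gegenbauer: "gegenbauer l d (cos \<theta>) = poly q (s \<theta>)" for \<theta>
    by (simp add: gegenbauer_eq_poly q_def s_def)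
  show ?thesis
  proof (rule that[of v' v''])
    show "((\<lambda>\<theta>. gegenbauer l d (cos \<theta>)) has_real_derivative v' \<theta>) (at \<theta>)" for \<theta>
      unfolding gegenbauer v'_def using chain[of q \<theta>] by (simp add: mult.commute)
    show "(v' has_real_derivative v'' \<theta>) (at \<theta>)" for \<theta>
    proof -
      have "((\<lambda>\<theta>. - (sin \<theta> / 2)) has_real_derivative - (cos \<theta> / 2)) (at \<theta>)"
        by (auto intro!: derivative_eq_intros)
      from DERIV_mult[OF this chain[of "pderiv q" \<theta>]] show ?thesis
        unfolding v'_def v''_def by (simp add: power2_eq_square algebra_simps)
    qed
    show "v' 0 = 0" by (simp add: v'_def)
    fix \<theta>
    have sin: "(sin \<theta>)\<^sup>2 / 4 = - (s \<theta> * (s \<theta> + 1))"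
      unfolding sin_squared_eq by (simp add: s_def field_simps power2_eq_square)
    have cos: "cos \<theta> = 2 * s \<theta> + 1" by (simp add: s_def field_simps)
    have "sin \<theta> * v'' \<theta> + (real d - 1) * cos \<theta> * v' \<theta> +
        real l * (real l + real d - 1) * sin \<theta> * poly q (s \<theta>) =
        - sin \<theta> * (s \<theta> * (s \<theta> + 1) * poly (pderiv (pderiv q)) (s \<theta>) +
          real d / 2 * (2 * s \<theta> + 1) * poly (pderiv q) (s \<theta>) -
          real l * (real l + real d - 1) * poly q (s \<theta>))"
      unfolding v'_def v''_def sin cos by (simp add: field_simps)
    also have "\<dots> = 0"
      using gegenbauer_hypergeometric_ode[where s = "s \<theta>" and l = l and d = d] by (simp add: q_def)
    finally show "sin \<theta> * v'' \<theta> + (real d - 1) * cos \<theta> * v' \<theta> +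
        real l * (real l + real d - 1) * sin \<theta> * gegenbauer l d (cos \<theta>) = 0"
      by (simp add: gegenbauer)
  qed
qed

section \<open>Zonal eigenfunctions\<close>

text \<open>
  The equation is that of an oscillator with friction coefficient \<open>n cot \<theta>\<close>. On the
  hemisphere \<open>\<theta> \<le> pi / 2\<close> the friction is nonnegative, so that the energy
  \<open>h'\<^sup>2 + \<kappa> h\<^sup>2\<close>, which starts at \<open>0\<close>, cannot increase. On the other hemisphere the friction
  is negative, but after multiplication by \<open>sin \<theta> ^ (2 n)\<close> the energy is nonincreasing again.
\<close>

lemma singular_ode_unique:
  fixes h h' h'' :: "real \<Rightarrow> real"
  assumes n: "n \<ge> 1" and \<kappa>: "\<kappa> > 0"
    and h: "\<And>\<theta>. (h has_real_derivative h' \<theta>) (at \<theta>)"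
    and h': "\<And>\<theta>. (h' has_real_derivative h'' \<theta>) (at \<theta>)"
    and ode: "\<And>\<theta>. 0 < \<theta> \<Longrightarrow> \<theta> < pi \<Longrightarrow>
      sin \<theta> * h'' \<theta> + real n * cos \<theta> * h' \<theta> + \<kappa> * sin \<theta> * h \<theta> = 0"
    and init: "h 0 = 0" "h' 0 = 0"
    and \<theta>: "0 \<le> \<theta>" "\<theta> \<le> pi"
  shows "h \<theta> = 0"
proof -
  define E where "E \<theta> = (h' \<theta>)\<^sup>2 + \<kappa> * (h \<theta>)\<^sup>2" for \<theta>
  define D where "D \<theta> = 2 * h' \<theta> * (h'' \<theta> + \<kappa> * h \<theta>)" for \<theta>
  have E: "(E has_real_derivative D \<theta>) (at \<theta>)" for \<theta>
    unfolding E_def D_def by (auto intro!: derivative_eq_intros h h' simp: algebra_simps)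
  have D: "sin \<theta> * D \<theta> = - 2 * real n * cos \<theta> * (h' \<theta>)\<^sup>2" if "0 < \<theta>" "\<theta> < pi" for \<theta>
  proof -
    have "sin \<theta> * D \<theta> = 2 * h' \<theta> * (sin \<theta> * h'' \<theta> + \<kappa> * sin \<theta> * h \<theta>)"
      by (simp add: D_def algebra_simps)
    also have "sin \<theta> * h'' \<theta> + \<kappa> * sin \<theta> * h \<theta> = - (real n * cos \<theta> * h' \<theta>)"
      using ode[OF that] by linarith
    finally show ?thesis by (simp add: power2_eq_square)
  qed
  have contE: "continuous_on S E" for S
    using E by (meson DERIV_continuous_on has_field_derivative_at_within)
  have E_nonneg: "E \<theta> \<ge> 0" for \<theta> using \<kappa> by (simp add: E_def)
  have h0: "h \<theta> = 0" if "E \<theta> = 0" for \<theta>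
    using that \<kappa> by (simp add: E_def add_nonneg_eq_0_iff)
  have first: "E \<theta> = 0" if "0 \<le> \<theta>" "\<theta> \<le> pi / 2" for \<theta>
  proof -
    have "E \<theta> \<le> E 0"
    proof (rule DERIV_nonpos_imp_decreasing_open[OF that(1) _ contE])
      fix x assume x: "0 < x" "x < \<theta>"
      then have "sin x > 0" "cos x \<ge> 0" using that by (auto intro!: sin_gt_zero cos_ge_zero)
      moreover have "sin x * D x = - 2 * real n * cos x * (h' x)\<^sup>2" using x that by (intro D) auto
      ultimately have "sin x * D x \<le> 0" by (simp add: mult_nonneg_nonneg)
      then have "D x \<le> 0" using \<open>sin x > 0\<close> by (simp add: mult_le_0_iff)
      then show "\<exists>y. (E has_real_derivative y) (at x) \<and> y \<le> 0" using E by blast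
    qed
    also have "E 0 = 0" by (simp add: E_def init)
    finally show ?thesis using E_nonneg[of \<theta>] by simp
  qed
  \<comment> \<open>The weight compensates the negative friction beyond the equator: only the potential part of the energy survives in the derivative of \<open>Q\<close>, with the sign of \<open>cos\<close>.\<close>
  define Q where "Q \<theta> = sin \<theta> ^ (2 * n) * E \<theta>" for \<theta>
  have second: "E \<theta> = 0" if "pi / 2 \<le> \<theta>" "\<theta> < pi" for \<theta>
  proof -
    have "Q \<theta> \<le> Q (pi / 2)"
    proof (rule DERIV_nonpos_imp_decreasing_open[OF that(1)])
      show "continuous_on {pi / 2..\<theta>} Q" unfolding Q_def by (intro continuous_intros contE)
      fix x assume x: "pi / 2 < x" "x < \<theta>"
      have x0: "0 < x" "x < pi" using x that pi_gt_zero by linarith+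
      then have sin: "sin x > 0" by (rule sin_gt_zero)
      have "cos x = - cos (pi - x)" by (simp add: cos_diff)
      moreover have "cos (pi - x) \<ge> 0" using x x0 by (intro cos_ge_zero) auto
      ultimately have cos: "cos x \<le> 0" by simp
      obtain m where m: "2 * n = Suc m" using n by (cases "2 * n") auto
      have "(Q has_real_derivative real (2 * n) * sin x ^ m * cos x * E x + sin x ^ (2 * n) * D x) (at x)"
        using DERIV_mult[OF DERIV_power[OF DERIV_sin[of x], of "2 * n"] E[of x]]
        unfolding Q_def m by (simp add: mult_ac add.commute)
      also have "real (2 * n) * sin x ^ m * cos x * E x + sin x ^ (2 * n) * D x =
          sin x ^ m * (2 * real n * cos x * E x + sin x * D x)"
      proof -
        have "sin x ^ (2 * n) = sin x * sin x ^ m" by (simp only: m power_Suc)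
        then show ?thesis by (simp add: algebra_simps)
      qed
      also have "2 * real n * cos x * E x + sin x * D x = 2 * real n * \<kappa> * (h x)\<^sup>2 * cos x"
        unfolding D[OF x0] by (simp add: E_def algebra_simps)
      finally have "(Q has_real_derivative sin x ^ m * (2 * real n * \<kappa> * (h x)\<^sup>2 * cos x)) (at x)" .
      moreover have "sin x ^ m * (2 * real n * \<kappa> * (h x)\<^sup>2 * cos x) \<le> 0"
        using sin cos \<kappa> by (intro mult_nonneg_nonpos) auto
      ultimately show "\<exists>y. (Q has_real_derivative y) (at x) \<and> y \<le> 0" by blast
    qed
    also have "Q (pi / 2) = 0" by (simp add: Q_def first)
    finally have "sin \<theta> ^ (2 * n) * E \<theta> \<le> 0" by (simp add: Q_def)
    moreover have "sin \<theta> ^ (2 * n) > 0" using that pi_gt_zero by (intro zero_less_power sin_gt_zero) linarith+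
    ultimately show ?thesis using E_nonneg[of \<theta>] by (simp add: mult_le_0_iff)
  qed
  have interior: "h \<theta> = 0" if "0 \<le> \<theta>" "\<theta> < pi" for \<theta>
    using first second h0 that by (cases "\<theta> \<le> pi / 2") auto
  have "h pi = 0"
  proof -
    have "isCont h pi" using h by (rule DERIV_isCont)
    then have "(h \<longlongrightarrow> h pi) (at_left pi)"
      by (simp add: continuous_at_imp_continuous_at_within continuous_within isCont_def filterlim_at_split)
    moreover have "eventually (\<lambda>x. h x = 0) (at_left pi)"
      using eventually_at_left_real[OF pi_gt_zero] by eventually_elim (auto intro: interior)
    ultimately have "((\<lambda>_. 0) \<longlongrightarrow> h pi) (at_left pi)" by (rule Lim_transform_eventually)
    then show ?thesis by (simp add: tendsto_const_iff)
  qed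
  then show ?thesis using interior \<theta> by (cases "\<theta> = pi") auto
qed

text \<open>
  A curve along which \<open>f\<close> is constant determines the Hessian of \<open>f\<close> in the direction of the
  velocity from first derivatives.
\<close>

lemma C2_derivs_constant_along_curve:
  assumes f: "C2_derivs U f f' f''" and c: "\<And>s. c s \<in> U"
    and v: "\<And>s. (c has_vector_derivative v s) (at s)" and w: "(v has_vector_derivative w) (at t)"
    and const: "\<And>s. f (c s) = k"
  shows "f' (c t) (v t) = 0" and "f'' (c t) (v t) (v t) = - f' (c t) w"
proof -
  have zero: "f' (c s) (v s) = 0" for s
    using C2_derivs_along_curve(1)[where c = c and v = v and t = s, OF f c v] unfolding const
    by (rule DERIV_unique[OF _ DERIV_const])
  then show "f' (c t) (v t) = 0" .
  have "f'' (c t) (v t) (v t) + f' (c t) w = 0"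
    using C2_derivs_along_curve(2)[where c = c and v = v and t = t, OF f c v w] unfolding zero
    by (rule DERIV_unique[OF _ DERIV_const])
  then show "f'' (c t) (v t) (v t) = - f' (c t) w" by simp
qed

lemma radial_extension_radial_derivs:
  assumes F: "C2_derivs (- {0}) (radial_extension f) F' F''" and x: "x \<noteq> 0"
  shows "F' x x = 0" "F'' x x x = 0"
proof -
  \<comment> \<open>Parametrized by \<open>exp\<close>, the ray never meets the origin and its velocity and acceleration coincide with its position.\<close>
  define c where "c = (\<lambda>s. exp s *\<^sub>R x)"
  have c: "(c has_vector_derivative c s) (at s)" for s
    unfolding c_def by (auto intro!: derivative_eq_intros simp: algebra_simps)
  have mem: "c s \<in> - {0}" for s using x by (simp add: c_def)
  have const: "radial_extension f (c s) = radial_extension f x" for s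
  proof -
    have "inverse (norm (c s)) * exp s = inverse (norm x)" by (simp add: c_def field_simps)
    moreover have "c s /\<^sub>R norm (c s) = (inverse (norm (c s)) * exp s) *\<^sub>R x"
      by (subst (1) c_def) simp
    ultimately show ?thesis by (simp add: radial_extension_def)
  qed
  from C2_derivs_constant_along_curve[where c = c and v = c and t = 0, OF F mem c c const]
  show "F' x x = 0" "F'' x x x = 0" by (simp_all add: c_def)
qed

text \<open>
  The Laplace-Beltrami operator on zonal functions, in the polar angle \<open>\<theta>\<close> measured from \<open>a\<close>. At
  the point \<open>\<gamma> \<theta> = cos \<theta> *\<^sub>R a + sin \<theta> *\<^sub>R b\<close> of a meridian the trace of the Hessian is computed in the orthonormal basis
  that consists of \<open>\<gamma> \<theta>\<close> itself, the tangent \<open>\<tau> \<theta>\<close> of the meridian and the remaining basis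
  vectors \<open>e\<close>. The radial direction contributes nothing, the tangent contributes the second
  derivative along the meridian, and each \<open>e\<close> contributes \<open>cot \<theta>\<close> times the first derivative,
  because the function is constant on the parallel through \<open>\<gamma> \<theta>\<close>.
\<close>

lemma zonal_eigenfunction_ode:
  fixes f :: "'a::euclidean_space \<Rightarrow> real"
  assumes f: "f \<in> laplace_beltrami_eigenspace c"
    and ab: "a \<in> Basis" "b \<in> Basis" "a \<noteq> b"
    and zonal: "\<And>x y. norm x = 1 \<Longrightarrow> norm y = 1 \<Longrightarrow> x \<bullet> a = y \<bullet> a \<Longrightarrow> f x = f y"
  obtains u' u'' where
    "\<And>\<theta>. ((\<lambda>\<theta>. f (cos \<theta> *\<^sub>R a + sin \<theta> *\<^sub>R b)) has_real_derivative u' \<theta>) (at \<theta>)"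
    "\<And>\<theta>. (u' has_real_derivative u'' \<theta>) (at \<theta>)"
    "u' 0 = 0"
    "\<And>\<theta>. sin \<theta> \<noteq> 0 \<Longrightarrow> sin \<theta> * u'' \<theta> + (real DIM('a) - 2) * cos \<theta> * u' \<theta> =
       c * sin \<theta> * f (cos \<theta> *\<^sub>R a + sin \<theta> *\<^sub>R b)"
proof -
  obtain F' F'' where F: "C2_derivs (- {0}) (radial_extension f) F' F''"
    and trace: "\<And>x. norm x = 1 \<Longrightarrow> (\<Sum>b\<in>Basis. F'' x b b) = c * f x" using f by (rule eigenspaceE) blast
  define \<gamma> where "\<gamma> = (\<lambda>\<theta>. cos \<theta> *\<^sub>R a + sin \<theta> *\<^sub>R b)"
  define \<tau> where "\<tau> = (\<lambda>\<theta>. cos \<theta> *\<^sub>R b - sin \<theta> *\<^sub>R a)"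
  have \<gamma>: "(\<gamma> has_vector_derivative \<tau> \<theta>) (at \<theta>)" for \<theta>
    unfolding \<gamma>_def \<tau>_def by (auto intro!: derivative_eq_intros simp: algebra_simps)
  have \<tau>: "(\<tau> has_vector_derivative - \<gamma> \<theta>) (at \<theta>)" for \<theta>
    unfolding \<gamma>_def \<tau>_def by (auto intro!: derivative_eq_intros simp: algebra_simps)
  have inner: "a \<bullet> a = 1" "b \<bullet> b = 1" "a \<bullet> b = 0" "b \<bullet> a = 0"
    using ab by (auto simp: inner_Basis)
  have norm_\<gamma>: "norm (\<gamma> \<theta>) = 1" and \<gamma>_a: "\<gamma> \<theta> \<bullet> a = cos \<theta>" for \<theta>
    by (auto simp: \<gamma>_def norm_eq_1 inner_add_left inner_add_right inner power2_eq_square[symmetric])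
  then have mem: "\<gamma> \<theta> \<in> - {0}" for \<theta> by (metis ComplI norm_zero singletonD zero_neq_one)
  have ext: "radial_extension f x = f x" if "norm x = 1" for x
    using that by (simp add: radial_extension_def)
  define u' where "u' = (\<lambda>\<theta>. F' (\<gamma> \<theta>) (\<tau> \<theta>))"
  define u'' where "u'' = (\<lambda>\<theta>. F'' (\<gamma> \<theta>) (\<tau> \<theta>) (\<tau> \<theta>))"
  have radial: "F' (\<gamma> \<theta>) (\<gamma> \<theta>) = 0" "F'' (\<gamma> \<theta>) (\<gamma> \<theta>) (\<gamma> \<theta>) = 0" for \<theta>
    using radial_extension_radial_derivs[OF F] mem by auto
  have u': "((\<lambda>\<theta>. f (\<gamma> \<theta>)) has_real_derivative u' \<theta>) (at \<theta>)" for \<theta>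
    using C2_derivs_along_curve(1)[where c = \<gamma> and v = \<tau> and t = \<theta>, OF F mem \<gamma>] by (simp add: ext norm_\<gamma> u'_def)
  have u'': "(u' has_real_derivative u'' \<theta>) (at \<theta>)" for \<theta>
    using C2_derivs_along_curve(2)[where c = \<gamma> and v = \<tau> and t = \<theta>, OF F mem \<gamma> \<tau>]
    by (simp add: u'_def u''_def blinfun.minus_right radial)
  have "u' 0 = 0"
  proof -
    have "f (\<gamma> (- \<theta>)) = f (\<gamma> \<theta>)" for \<theta> by (rule zonal) (simp_all add: norm_\<gamma> \<gamma>_a)
    then have "((\<lambda>\<theta>. f (\<gamma> \<theta>)) has_real_derivative - u' 0) (at 0)"
      using u'[of "- 0"] unfolding DERIV_mirror by simp
    with u'[of 0] have "u' 0 = - u' 0" by (rule DERIV_unique)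
    then show ?thesis by simp
  qed
  moreover have "sin \<theta> * u'' \<theta> + (real DIM('a) - 2) * cos \<theta> * u' \<theta> = c * sin \<theta> * f (\<gamma> \<theta>)"
    if sin: "sin \<theta> \<noteq> 0" for \<theta>
  proof -
    have "F' (\<gamma> \<theta>) b = F' (\<gamma> \<theta>) (cos \<theta> *\<^sub>R \<tau> \<theta> + sin \<theta> *\<^sub>R \<gamma> \<theta>)"
    proof -
      have "cos \<theta> *\<^sub>R \<tau> \<theta> + sin \<theta> *\<^sub>R \<gamma> \<theta> = ((cos \<theta>)\<^sup>2 + (sin \<theta>)\<^sup>2) *\<^sub>R b"
        by (simp only: \<tau>_def \<gamma>_def scaleR_right_diff_distrib scaleR_add_right scaleR_scaleR
            scaleR_add_left power2_eq_square) (simp add: mult.commute)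
      then show ?thesis by simp
    qed
    then have F'_b: "F' (\<gamma> \<theta>) b = cos \<theta> * u' \<theta>"
      by (simp add: blinfun.add_right blinfun.scaleR_right radial u'_def)
    \<comment> \<open>Move along the parallel through \<open>\<gamma> \<theta>\<close>; its acceleration at \<open>\<gamma> \<theta>\<close> is \<open>- (sin \<theta> *\<^sub>R b)\<close>.\<close>
    have transversal: "sin \<theta> * F'' (\<gamma> \<theta>) e e = cos \<theta> * u' \<theta>" if e: "e \<in> Basis - {a, b}" for e
    proof -
      define \<delta> where "\<delta> = (\<lambda>s. cos \<theta> *\<^sub>R a + sin \<theta> *\<^sub>R (cos s *\<^sub>R b + sin s *\<^sub>R e))"
      define \<delta>' where "\<delta>' = (\<lambda>s. sin \<theta> *\<^sub>R (cos s *\<^sub>R e - sin s *\<^sub>R b))"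
      have \<delta>: "(\<delta> has_vector_derivative \<delta>' s) (at s)" for s
        unfolding \<delta>_def \<delta>'_def by (auto intro!: derivative_eq_intros simp: algebra_simps)
      have \<delta>': "(\<delta>' has_vector_derivative - (sin \<theta> *\<^sub>R b)) (at 0)"
        unfolding \<delta>'_def by (auto intro!: derivative_eq_intros simp: algebra_simps)
      have e_inner: "e \<bullet> e = 1" "e \<bullet> a = 0" "e \<bullet> b = 0" "a \<bullet> e = 0" "b \<bullet> e = 0"
        using e ab by (auto simp: inner_Basis)
      have \<delta>_a: "\<delta> s \<bullet> a = cos \<theta>" for s
        by (simp add: \<delta>_def inner_add_left inner e_inner)
      have "\<delta> s \<bullet> \<delta> s = (cos \<theta>)\<^sup>2 + (sin \<theta>)\<^sup>2 * ((cos s)\<^sup>2 + (sin s)\<^sup>2)" for s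
        unfolding \<delta>_def by (simp only: inner_add_left inner_add_right inner_scaleR_left inner_scaleR_right
          inner e_inner) (simp only: algebra_simps power2_eq_square mult_zero_right mult_zero_left
          mult_1_right add_0_left add_0_right)
      then have norm_\<delta>: "norm (\<delta> s) = 1" for s by (simp add: norm_eq_1)
      have mem_\<delta>: "\<delta> s \<in> - {0}" for s
        using norm_\<delta>[of s] by auto
      have const: "radial_extension f (\<delta> s) = f (\<gamma> \<theta>)" for s
        using zonal[of "\<delta> s" "\<gamma> \<theta>"] norm_\<delta>[of s] by (simp add: ext norm_\<gamma> \<gamma>_a \<delta>_a)
      have \<delta>0: "\<delta> 0 = \<gamma> \<theta>" by (simp add: \<delta>_def \<gamma>_def)
      have "F'' (\<gamma> \<theta>) (sin \<theta> *\<^sub>R e) (sin \<theta> *\<^sub>R e) = - F' (\<gamma> \<theta>) (- (sin \<theta> *\<^sub>R b))"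
        using C2_derivs_constant_along_curve(2)[where c = \<delta> and v = \<delta>' and t = 0, OF F mem_\<delta> \<delta> \<delta>' const]
        by (simp add: \<delta>0 \<delta>'_def)
      then have "sin \<theta> * (sin \<theta> * F'' (\<gamma> \<theta>) e e) = sin \<theta> * (cos \<theta> * u' \<theta>)"
        by (simp add: blinfun.scaleR_right blinfun.scaleR_left blinfun.minus_right F'_b)
      then show ?thesis using sin by simp
    qed
    have plane: "F'' (\<gamma> \<theta>) a a + F'' (\<gamma> \<theta>) b b = u'' \<theta>"
    proof -
      \<comment> \<open>The trace over the plane of \<open>a\<close> and \<open>b\<close> does not change when the basis is rotated to \<open>\<gamma> \<theta>\<close> and \<open>\<tau> \<theta>\<close>.\<close>
      have rotate: "((cos \<theta>)\<^sup>2 + (sin \<theta>)\<^sup>2) * (H a a + H b b) =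
          H (cos \<theta> *\<^sub>R a + sin \<theta> *\<^sub>R b) (cos \<theta> *\<^sub>R a + sin \<theta> *\<^sub>R b) +
          H (cos \<theta> *\<^sub>R b - sin \<theta> *\<^sub>R a) (cos \<theta> *\<^sub>R b - sin \<theta> *\<^sub>R a)" for H :: "'a \<Rightarrow>\<^sub>L 'a \<Rightarrow>\<^sub>L real"
        by (simp only: blinfun.add_right blinfun.add_left blinfun.diff_right blinfun.diff_left
          blinfun.scaleR_right blinfun.scaleR_left real_scaleR_def)
          (simp only: algebra_simps power2_eq_square)
      have "F'' (\<gamma> \<theta>) (\<gamma> \<theta>) (\<gamma> \<theta>) + F'' (\<gamma> \<theta>) (\<tau> \<theta>) (\<tau> \<theta>) =
          ((cos \<theta>)\<^sup>2 + (sin \<theta>)\<^sup>2) * (F'' (\<gamma> \<theta>) a a + F'' (\<gamma> \<theta>) b b)"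
        unfolding rotate by (simp add: \<gamma>_def \<tau>_def)
      then show ?thesis by (simp add: radial u''_def)
    qed
    have "c * sin \<theta> * f (\<gamma> \<theta>) = sin \<theta> * (\<Sum>e\<in>Basis. F'' (\<gamma> \<theta>) e e)"
      by (simp add: trace norm_\<gamma>)
    also have "(\<Sum>e\<in>Basis. F'' (\<gamma> \<theta>) e e) = u'' \<theta> + (\<Sum>e\<in>Basis - {a, b}. F'' (\<gamma> \<theta>) e e)"
    proof -
      have "(\<Sum>e\<in>Basis. F'' (\<gamma> \<theta>) e e) = (\<Sum>e\<in>Basis - {a, b}. F'' (\<gamma> \<theta>) e e) + (\<Sum>e\<in>{a, b}. F'' (\<gamma> \<theta>) e e)"
        by (rule sum.subset_diff) (use ab in auto)
      then show ?thesis using ab by (simp add: plane)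
    qed
    also have "sin \<theta> * \<dots> = sin \<theta> * u'' \<theta> + (\<Sum>e\<in>Basis - {a, b}. cos \<theta> * u' \<theta>)"
      by (simp add: distrib_left sum_distrib_left transversal)
    also have "(\<Sum>e\<in>Basis - {a, b}. cos \<theta> * u' \<theta>) = (real DIM('a) - 2) * cos \<theta> * u' \<theta>"
    proof -
      have "card {a, b} = 2" using ab by simp
      then have "card (Basis - {a, b}) = DIM('a) - 2" "2 \<le> DIM('a)"
        using ab card_mono[of Basis "{a, b}"] by (simp_all add: card_Diff_subset)
      then show ?thesis by (simp add: of_nat_diff)
    qed
    finally show ?thesis by simp
  qed
  ultimately show ?thesis using u' u'' unfolding \<gamma>_def by (rule that[rotated 2])
qed

text \<open>
  By \<open>zonal_eigenfunction_ode\<close> and \<open>gegenbauer_cos_ode\<close> the difference of both sides along a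
  meridian solves the equation of \<open>singular_ode_unique\<close>. It vanishes at the pole because \<open>G(1) = 1\<close>,
  and its derivative vanishes there because a zonal function is even in \<open>\<theta>\<close>.
\<close>

theorem zonal_eigenfunction_eq_gegenbauer:
  fixes f :: "'a::euclidean_space \<Rightarrow> real"
  assumes d: "DIM('a) = d + 1" "d \<ge> 2" and l: "l \<ge> 1"
    and f: "f \<in> laplace_beltrami_eigenspace (- (real l * (real l + real d - 1)))"
    and a: "a \<in> Basis"
    and zonal: "\<And>x y. norm x = 1 \<Longrightarrow> norm y = 1 \<Longrightarrow> x \<bullet> a = y \<bullet> a \<Longrightarrow> f x = f y"
    and x: "norm x = 1"
  shows "f x = f a * gegenbauer l d (x \<bullet> a)"
proof -
  define \<kappa> where "\<kappa> = real l * (real l + real d - 1)"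
  have "\<kappa> > 0" using d l by (simp add: \<kappa>_def)
  have "\<not> Basis \<subseteq> {a}"
  proof
    assume "(Basis :: 'a set) \<subseteq> {a}"
    from card_mono[OF _ this] show False using d by simp
  qed
  then obtain b where b: "b \<in> Basis" "a \<noteq> b" by auto
  let ?\<gamma> = "\<lambda>\<theta>. cos \<theta> *\<^sub>R a + sin \<theta> *\<^sub>R b"
  obtain u' u'' where u: "\<And>\<theta>. ((\<lambda>\<theta>. f (?\<gamma> \<theta>)) has_real_derivative u' \<theta>) (at \<theta>)"
      "\<And>\<theta>. (u' has_real_derivative u'' \<theta>) (at \<theta>)" "u' 0 = 0"
      "\<And>\<theta>. sin \<theta> \<noteq> 0 \<Longrightarrow> sin \<theta> * u'' \<theta> + (real DIM('a) - 2) * cos \<theta> * u' \<theta> =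
        - \<kappa> * sin \<theta> * f (?\<gamma> \<theta>)"
    using zonal_eigenfunction_ode[OF f a b zonal] unfolding \<kappa>_def by blast
  obtain v' v'' where v: "\<And>\<theta>. ((\<lambda>\<theta>. gegenbauer l d (cos \<theta>)) has_real_derivative v' \<theta>) (at \<theta>)"
      "\<And>\<theta>. (v' has_real_derivative v'' \<theta>) (at \<theta>)" "v' 0 = 0"
      "\<And>\<theta>. sin \<theta> * v'' \<theta> + (real d - 1) * cos \<theta> * v' \<theta> + \<kappa> * sin \<theta> * gegenbauer l d (cos \<theta>) = 0"
    using gegenbauer_cos_ode[of l d] unfolding \<kappa>_def by blast
  define h where "h \<theta> = f (?\<gamma> \<theta>) - f a * gegenbauer l d (cos \<theta>)" for \<theta>
  define h' where "h' \<theta> = u' \<theta> - f a * v' \<theta>" for \<theta>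
  define h'' where "h'' \<theta> = u'' \<theta> - f a * v'' \<theta>" for \<theta>
  have h: "h \<theta> = 0" if "0 \<le> \<theta>" "\<theta> \<le> pi" for \<theta>
  proof (rule singular_ode_unique[where n = "d - 1" and h = h and h' = h' and h'' = h'', OF _ \<open>\<kappa> > 0\<close> _ _ _ _ _ that])
    show "(h has_real_derivative h' \<theta>) (at \<theta>)" "(h' has_real_derivative h'' \<theta>) (at \<theta>)" for \<theta>
      unfolding h_def h'_def h''_def by (intro DERIV_diff DERIV_cmult u v)+
    show "h 0 = 0" using d by (simp add: h_def gegenbauer_at_1)
    show "h' 0 = 0" by (simp add: h'_def u v)
    show "1 \<le> d - 1" using d by simp
    show "sin \<theta> * h'' \<theta> + real (d - 1) * cos \<theta> * h' \<theta> + \<kappa> * sin \<theta> * h \<theta> = 0"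
      if "0 < \<theta>" "\<theta> < pi" for \<theta>
    proof -
      have "sin \<theta> \<noteq> 0" using sin_gt_zero[OF that] by simp
      then have "sin \<theta> * u'' \<theta> + (real d - 1) * cos \<theta> * u' \<theta> + \<kappa> * sin \<theta> * f (?\<gamma> \<theta>) = 0"
        using u(4)[of \<theta>] d by simp
      moreover have "f a * (sin \<theta> * v'' \<theta> + (real d - 1) * cos \<theta> * v' \<theta> + \<kappa> * sin \<theta> * gegenbauer l d (cos \<theta>)) = 0"
        by (simp add: v)
      ultimately show ?thesis using d
        by (simp add: h_def h'_def h''_def of_nat_diff algebra_simps)
    qed
  qed
  define \<theta> where "\<theta> = arccos (x \<bullet> a)"
  have "\<bar>x \<bullet> a\<bar> \<le> 1" using Cauchy_Schwarz_ineq2[of x a] x a by simp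
  then have \<theta>: "0 \<le> \<theta>" "\<theta> \<le> pi" "cos \<theta> = x \<bullet> a"
    by (auto simp: \<theta>_def arccos_lbound arccos_ubound cos_arccos abs_le_iff)
  have inner: "a \<bullet> a = 1" "b \<bullet> b = 1" "a \<bullet> b = 0" "b \<bullet> a = 0" using a b by (auto simp: inner_Basis)
  have "f x = f (?\<gamma> \<theta>)"
  proof (rule zonal[OF x])
    show "norm (?\<gamma> \<theta>) = 1"
      by (simp add: norm_eq_1 inner_add_left inner_add_right inner power2_eq_square[symmetric])
    show "x \<bullet> a = ?\<gamma> \<theta> \<bullet> a" by (simp add: inner_add_left inner \<theta>)
  qed
  then show ?thesis using h[OF \<theta>(1,2)] \<theta>(3) by (simp add: h_def)
qed

section \<open>Rotation invariant kernels\<close>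

text \<open>
  The reflection \<open>T\<close> that exchanges \<open>x\<close> and \<open>y\<close> fixes every \<open>a\<close> orthogonal to \<open>x - y\<close>. If
  \<open>x = y\<close>, the formula for \<open>T\<close> divides by zero and \<open>T\<close> is the identity, as it should be.
\<close>

lemma orthogonal_transformation_fixing:
  fixes x y a :: "'a::euclidean_space"
  assumes "norm x = norm y" "x \<bullet> a = y \<bullet> a"
  obtains T where "orthogonal_transformation T" "T x = y" "T a = a"
proof -
  define v where "v = x - y"
  define T where "T = (\<lambda>z. z - (2 * (z \<bullet> v) / (v \<bullet> v)) *\<^sub>R v)"
  have xy: "x \<bullet> x = y \<bullet> y" using assms(1) by (simp add: norm_eq)
  have "linear T"
    by (rule linearI) (simp_all add: T_def inner_add_left algebra_simps add_divide_distrib)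
  moreover have "T z \<bullet> T w = z \<bullet> w" for z w
  proof (cases "v = 0")
    case False
    define r where "r z = 2 * (z \<bullet> v) / (v \<bullet> v)" for z
    have r: "r z * (v \<bullet> v) = 2 * (z \<bullet> v)" for z using False by (simp add: r_def)
    have "T z \<bullet> T w = z \<bullet> w - r w * (z \<bullet> v) - r z * (w \<bullet> v) + r z * (r w * (v \<bullet> v))"
      unfolding T_def r_def[symmetric]
      by (simp add: inner_diff_left inner_diff_right inner_commute[of v w] algebra_simps)
    also have "r z * (w \<bullet> v) = r w * (z \<bullet> v)" by (simp add: r_def)
    finally show ?thesis unfolding r by (simp add: r_def)
  qed (simp add: T_def)
  ultimately have "orthogonal_transformation T" by (simp add: orthogonal_transformation_def)
  moreover have "T x = y"
  proof (cases "v = 0")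
    case False
    have "2 * (x \<bullet> v) = v \<bullet> v"
      using xy by (simp add: v_def inner_diff_left inner_diff_right inner_commute)
    then have "T x = x - v" using False by (simp add: T_def)
    then show ?thesis by (simp add: v_def)
  qed (simp add: T_def v_def)
  moreover have "T a = a"
  proof -
    have "a \<bullet> v = 0" using assms(2) by (simp add: v_def inner_diff_right inner_commute)
    then show ?thesis by (simp add: T_def)
  qed
  ultimately show ?thesis by (rule that)
qed

text \<open>
  Invariance under the orthogonal maps that fix the pole \<open>a\<close> makes \<open>k(\<cdot>, a)\<close> zonal; invariance
  under the others moves an arbitrary \<open>y\<close> to the pole.
\<close>

theorem invariant_kernel_eq_gegenbauer:
  fixes k :: "real^'n \<Rightarrow> real^'n \<Rightarrow> real"
  assumes d: "CARD('n) = d + 1" "d \<ge> 2" and l: "l \<ge> 1"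
    and k: "\<And>y. norm y = 1 \<Longrightarrow> (\<lambda>x. k x y) \<in> laplace_beltrami_eigenspace (- (real l * (real l + real d - 1)))"
    and invariant: "\<And>T x y. orthogonal_transformation T \<Longrightarrow> norm x = 1 \<Longrightarrow> norm y = 1 \<Longrightarrow> k (T x) (T y) = k x y"
  obtains c where "\<And>x y. norm x = 1 \<Longrightarrow> norm y = 1 \<Longrightarrow> k x y = c * gegenbauer l d (x \<bullet> y)"
proof -
  obtain a :: "real^'n" where a: "a \<in> Basis" using nonempty_Basis by blast
  have zonal: "k x a = k a a * gegenbauer l d (x \<bullet> a)" if "norm x = 1" for x
  proof (rule zonal_eigenfunction_eq_gegenbauer[where f = "\<lambda>x. k x a", OF _ d(2) l _ a _ that])
    show "DIM(real^'n) = d + 1" using d by simp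
    show "(\<lambda>x. k x a) \<in> laplace_beltrami_eigenspace (- (real l * (real l + real d - 1)))"
      using a by (intro k) simp
    fix x y :: "real^'n" assume xy: "norm x = 1" "norm y = 1" "x \<bullet> a = y \<bullet> a"
    then obtain T where T: "orthogonal_transformation T" "T x = y" "T a = a"
      using orthogonal_transformation_fixing[of x y a] by auto
    show "k x a = k y a" using invariant[OF T(1) xy(1), of a] T a by simp
  qed
  show ?thesis
  proof (rule that[of "k a a"])
    fix x y :: "real^'n" assume xy: "norm x = 1" "norm y = 1"
    then obtain T where T: "orthogonal_transformation T" "T y = a"
      using orthogonal_transformation_exists_1[of y a] a by auto
    have "k x y = k (T x) a" using invariant[OF T(1) xy] T by simp
    also have "\<dots> = k a a * gegenbauer l d (T x \<bullet> T y)"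
      using zonal[of "T x"] T xy by (simp add: orthogonal_transformation_norm)
    also have "T x \<bullet> T y = x \<bullet> y" using T(1) by (simp only: orthogonal_transformation_def)
    finally show "k x y = k a a * gegenbauer l d (x \<bullet> y)" .
  qed
qed

lemma integral_sphere_gegenbauer_cube:
  fixes u :: "real^'n"
  assumes d: "d \<ge> 2" "CARD('n) = d + 1" "CARD('k::finite) = d" and u: "norm u = 1"
  shows "(\<integral>v. gegenbauer l d (u \<bullet> v) ^ 3 \<partial>sphere_measure) =
    sphere_area TYPE(real^'k) * integral {-1..1} (\<lambda>t. gegenbauer l d t ^ 3 * sqrt (1 - t\<^sup>2) ^ (d - 2))"
proof -
  define p where "p = (pcompose (gegenbauer_shifted_poly l d) [:- 1 / 2, 1 / 2:]) ^ 3"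
  have p: "gegenbauer l d t ^ 3 = poly p t" for t
  proof -
    have "poly [:- 1 / 2, 1 / 2:] t = (t - 1) / 2" by (simp add: field_simps)
    then show ?thesis by (simp only: p_def poly_power poly_pcompose gegenbauer_eq_poly)
  qed
  obtain a :: "real^'n" where a: "a \<in> Basis" using nonempty_Basis by blast
  obtain T where T: "orthogonal_transformation T" "T a = u"
    using orthogonal_transformation_exists_1[of a u] a u by auto
  have "(\<integral>v. poly p (u \<bullet> v) \<partial>sphere_measure) = (\<integral>v. poly p (u \<bullet> T v) \<partial>sphere_measure)"
    by (rule integral_sphere_orthogonal[OF T(1), symmetric]) (intro continuous_intros)
  also have "\<dots> = (\<integral>v. poly p (v \<bullet> a) \<partial>sphere_measure)"
    using T by (auto simp: orthogonal_transformation_def inner_commute)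
  also have "\<dots> = sphere_area TYPE(real^'k) * integral {-1..1} (\<lambda>t. poly p t * sqrt (1 - t\<^sup>2) ^ (d - 2))"
    by (rule integral_sphere_zonal[OF a d])
  finally show ?thesis by (simp add: p)
qed


section \<open>The reproducing kernel of an eigenspace\<close>

lemma sum_rotate:
  "(\<Sum>i\<in>A. \<Sum>j\<in>B. \<Sum>k\<in>C. f i j k) = (\<Sum>k\<in>C. \<Sum>i\<in>A. \<Sum>j\<in>B. f i j k)"
proof -
  have "(\<Sum>i\<in>A. \<Sum>j\<in>B. \<Sum>k\<in>C. f i j k) = (\<Sum>i\<in>A. \<Sum>k\<in>C. \<Sum>j\<in>B. f i j k)"
    by (rule sum.cong[OF refl], rule sum.swap)
  also have "\<dots> = (\<Sum>k\<in>C. \<Sum>i\<in>A. \<Sum>j\<in>B. f i j k)" by (rule sum.swap)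
  finally show ?thesis .
qed

text \<open>
  The kernel and the Gram matrix are studied for an arbitrary eigenvalue; that invariant kernels
  are Gegenbauer polynomials comes in only when the eigenvalue is specialized.
\<close>

locale eigenspace_basis =
  fixes c :: real and I :: "'i set" and Y :: "'i \<Rightarrow> real^'n \<Rightarrow> real"
  assumes basis: "L2_orthonormal_basis (laplace_beltrami_eigenspace c) I Y"
begin

lemma finite_I: "finite I"
  and Y_eigen: "i \<in> I \<Longrightarrow> Y i \<in> laplace_beltrami_eigenspace c"
  and orthonormal: "i \<in> I \<Longrightarrow> j \<in> I \<Longrightarrow> (\<integral>x. Y i x * Y j x \<partial>sphere_measure) = (if i = j then 1 else 0)"
  using basis by (auto simp: L2_orthonormal_basis_def)

lemma Y_continuous [continuous_intros]: "i \<in> I \<Longrightarrow> continuous_on (sphere 0 1) (Y i)"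
  by (rule eigenspace_continuous_on[OF Y_eigen])

lemma integrable_YY: "i \<in> I \<Longrightarrow> j \<in> I \<Longrightarrow> integrable sphere_measure (\<lambda>x. Y i x * Y j x)"
  by (intro integrable_continuous_on_sphere continuous_intros)

definition K :: "real^'n \<Rightarrow> real^'n \<Rightarrow> real" where
  "K x y = (\<Sum>i\<in>I. Y i x * Y i y)"

lemma K_commute: "K x y = K y x"
  by (simp add: K_def mult.commute)

lemma K_eigen: "(\<lambda>x. K x y) \<in> laplace_beltrami_eigenspace c"
  unfolding K_def using eigenspace_linear_combination[where f = Y and k = "\<lambda>i. Y i y" and I = I, OF Y_eigen]
  by (simp add: mult.commute)

lemma K_continuous [continuous_intros]:
  "continuous_on (sphere 0 1) (\<lambda>x. K x y)" "continuous_on (sphere 0 1) (\<lambda>x. K y x)"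
  unfolding K_commute[of y] by (rule eigenspace_continuous_on[OF K_eigen])+

lemma integral_Y_lincomb:
  assumes "j \<in> I"
  shows "(\<integral>x. (\<Sum>i\<in>I. k i * Y i x) * Y j x \<partial>sphere_measure) = k j"
proof -
  have "(\<integral>x. (\<Sum>i\<in>I. k i * Y i x) * Y j x \<partial>sphere_measure) =
      (\<Sum>i\<in>I. k i * (\<integral>x. Y i x * Y j x \<partial>sphere_measure))"
    unfolding sum_distrib_right
    by (subst Bochner_Integration.integral_sum) (use assms integrable_YY in \<open>auto simp: mult.assoc\<close>)
  also have "\<dots> = (\<Sum>i\<in>I. if i = j then k i else 0)"
    by (intro sum.cong refl) (simp add: orthonormal assms)
  finally show ?thesis using assms finite_I by simp
qed

lemma reproducing:
  assumes f: "f \<in> laplace_beltrami_eigenspace c" and x: "norm x = 1"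
  shows "(\<integral>y. K x y * f y \<partial>sphere_measure) = f x"
proof -
  obtain k where k: "\<And>x. norm x = 1 \<Longrightarrow> f x = (\<Sum>i\<in>I. k i * Y i x)"
    using basis f by (auto simp: L2_orthonormal_basis_def)
  have "(\<integral>y. K x y * f y \<partial>sphere_measure) =
      (\<integral>y. (\<Sum>j\<in>I. Y j x * ((\<Sum>i\<in>I. k i * Y i y) * Y j y)) \<partial>sphere_measure)"
    by (intro Bochner_Integration.integral_cong refl)
      (simp add: k K_def sum_distrib_left sum_distrib_right mult_ac)
  also have "\<dots> = (\<Sum>j\<in>I. Y j x * (\<integral>y. (\<Sum>i\<in>I. k i * Y i y) * Y j y \<partial>sphere_measure))"
    by (subst Bochner_Integration.integral_sum)
      (auto intro!: integrable_continuous_on_sphere continuous_intros)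
  also have "\<dots> = (\<Sum>j\<in>I. k j * Y j x)"
    by (intro sum.cong refl) (simp add: integral_Y_lincomb)
  finally show ?thesis using k x by simp
qed

text \<open>
  A reproducing kernel is determined by the space and its scalar product, both of which \<open>T\<close>
  preserves. Explicitly, \<open>z \<mapsto> K (T z) (T x)\<close> lies in the space and is reproduced at \<open>y\<close> by the
  kernel; substituting \<open>T z\<close> for the variable lets the kernel act once more.
\<close>

lemma K_invariant:
  assumes T: "orthogonal_transformation T" and xy: "norm x = 1" "norm y = 1"
  shows "K (T x) (T y) = K x y"
proof -
  note iT = orthogonal_transformation_inv[OF T]
  have inv: "inv T (T z) = z" for z using T by (simp add: orthogonal_transformation_inj)
  have Tx: "norm (T x) = 1" using xy T by (simp add: orthogonal_transformation_norm)
  have cont: "continuous_on (sphere 0 1) (\<lambda>z. K (T x) z * K (inv T z) y)"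
    by (intro continuous_intros eigenspace_continuous_on[OF eigenspace_orthogonal_transformation[OF iT K_eigen]])
  have "K (T x) (T y) = K (T y) (T x)" by (rule K_commute)
  also have "\<dots> = (\<integral>z. K y z * K (T z) (T x) \<partial>sphere_measure)"
    by (rule reproducing[OF eigenspace_orthogonal_transformation[OF T K_eigen] xy(2), symmetric])
  also have "\<dots> = (\<integral>z. K (T x) (T z) * K (inv T (T z)) y \<partial>sphere_measure)"
    unfolding inv K_commute[of "T x"] K_commute[of y] by (simp only: mult.commute)
  also have "\<dots> = (\<integral>z. K (T x) z * K (inv T z) y \<partial>sphere_measure)"
    by (rule integral_sphere_orthogonal[OF T cont])
  also have "\<dots> = K x y"
    using reproducing[OF eigenspace_orthogonal_transformation[OF iT K_eigen] Tx] by (simp add: inv)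
  finally show ?thesis .
qed

definition triple :: "'i \<Rightarrow> 'i \<Rightarrow> 'i \<Rightarrow> real" where
  "triple i j k = (\<integral>x. Y i x * Y j x * Y k x \<partial>sphere_measure)"

definition gram :: "'i \<Rightarrow> 'i \<Rightarrow> real" where
  "gram M M' = (\<Sum>i\<in>I. \<Sum>j\<in>I. triple i j M * triple i j M')"

text \<open>
  The orthogonal projection of \<open>Y i * Y j\<close> to the eigenspace.
\<close>

definition product_proj :: "'i \<Rightarrow> 'i \<Rightarrow> real^'n \<Rightarrow> real" where
  "product_proj i j x = (\<integral>u. K x u * (Y i u * Y j u) \<partial>sphere_measure)"

lemma product_proj_eq:
  assumes "i \<in> I" "j \<in> I"
  shows "product_proj i j x = (\<Sum>M\<in>I. triple i j M * Y M x)"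
proof -
  have "product_proj i j x = (\<integral>u. (\<Sum>M\<in>I. Y M x * (Y i u * Y j u * Y M u)) \<partial>sphere_measure)"
    unfolding product_proj_def K_def sum_distrib_right by (simp only: mult_ac)
  also have "\<dots> = (\<Sum>M\<in>I. Y M x * triple i j M)"
    unfolding triple_def using assms
    by (subst Bochner_Integration.integral_sum)
      (auto intro!: integrable_continuous_on_sphere continuous_intros)
  finally show ?thesis by (simp add: mult.commute)
qed

text \<open>
  The value at \<open>y\<close> of the projection of \<open>(K u)\<^sup>2\<close> to the eigenspace.
\<close>

definition square_proj :: "real^'n \<Rightarrow> real^'n \<Rightarrow> real" where
  "square_proj y u = (\<integral>v. K y v * (K u v)\<^sup>2 \<partial>sphere_measure)"

lemma square_proj_eq:
  "square_proj y u = (\<Sum>i\<in>I. \<Sum>j\<in>I. Y i u * Y j u * product_proj i j y)"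
proof -
  have "square_proj y u =
      (\<integral>v. (\<Sum>i\<in>I. \<Sum>j\<in>I. Y i u * Y j u * (K y v * (Y i v * Y j v))) \<partial>sphere_measure)"
    unfolding square_proj_def K_def[of u] power2_eq_square sum_product
    by (simp add: sum_distrib_left mult_ac)
  also have "\<dots> = (\<Sum>i\<in>I. \<integral>v. (\<Sum>j\<in>I. Y i u * Y j u * (K y v * (Y i v * Y j v))) \<partial>sphere_measure)"
    by (intro Bochner_Integration.integral_sum integrable_continuous_on_sphere continuous_intros) 
  also have "\<dots> = (\<Sum>i\<in>I. \<Sum>j\<in>I. Y i u * Y j u * product_proj i j y)"
    unfolding product_proj_def
    by (intro sum.cong refl, subst Bochner_Integration.integral_sum)
      (auto intro!: integrable_continuous_on_sphere continuous_intros)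
  finally show ?thesis .
qed

lemma square_proj_continuous [continuous_intros]:
  "continuous_on (sphere 0 1) (square_proj y)"
  unfolding square_proj_eq[abs_def] by (intro continuous_intros)

lemma square_proj_invariant:
  assumes T: "orthogonal_transformation T" and yu: "norm y = 1" "norm u = 1"
  shows "square_proj (T y) (T u) = square_proj y u"
proof -
  have "square_proj (T y) (T u) = (\<integral>v. K (T y) (T v) * (K (T u) (T v))\<^sup>2 \<partial>sphere_measure)"
    unfolding square_proj_def
    by (rule integral_sphere_orthogonal[OF T, symmetric]) (intro continuous_intros)
  also have "\<dots> = square_proj y u"
    unfolding square_proj_def
    by (intro Bochner_Integration.integral_cong refl) (simp add: K_invariant[OF T] yu)
  finally show ?thesis .
qed

text \<open>
  The kernel \<open>(\<integral>u. \<integral>v. K x u * (K u v)\<^sup>2 * K v y)\<close>. In this form its invariance is visible, while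
  \<open>gram_kernel_eq\<close> shows that its coefficients in the basis \<open>Y\<close> are the entries of \<open>gram\<close>.
\<close>

definition gram_kernel :: "real^'n \<Rightarrow> real^'n \<Rightarrow> real" where
  "gram_kernel x y = (\<integral>u. K x u * square_proj y u \<partial>sphere_measure)"

lemma gram_kernel_invariant:
  assumes T: "orthogonal_transformation T" and xy: "norm x = 1" "norm y = 1"
  shows "gram_kernel (T x) (T y) = gram_kernel x y"
proof -
  have "gram_kernel (T x) (T y) = (\<integral>u. K (T x) (T u) * square_proj (T y) (T u) \<partial>sphere_measure)"
    unfolding gram_kernel_def
    by (rule integral_sphere_orthogonal[OF T, symmetric]) (intro continuous_intros)
  also have "\<dots> = gram_kernel x y"
    unfolding gram_kernel_def
    by (intro Bochner_Integration.integral_cong refl)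
      (simp add: K_invariant[OF T] square_proj_invariant[OF T] xy)
  finally show ?thesis .
qed

lemma gram_kernel_eq:
  "gram_kernel x y = (\<Sum>M\<in>I. (\<Sum>M'\<in>I. gram M M' * Y M' y) * Y M x)"
proof -
  have "gram_kernel x y =
      (\<integral>u. (\<Sum>i\<in>I. \<Sum>j\<in>I. product_proj i j y * (K x u * (Y i u * Y j u))) \<partial>sphere_measure)"
    unfolding gram_kernel_def square_proj_eq by (simp add: sum_distrib_left mult_ac)
  also have "\<dots> = (\<Sum>i\<in>I. \<integral>u. (\<Sum>j\<in>I. product_proj i j y * (K x u * (Y i u * Y j u))) \<partial>sphere_measure)"
    by (intro Bochner_Integration.integral_sum integrable_continuous_on_sphere continuous_intros) 
  also have "\<dots> = (\<Sum>i\<in>I. \<Sum>j\<in>I. product_proj i j y * product_proj i j x)"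
    unfolding product_proj_def[of _ _ x]
    by (intro sum.cong refl, subst Bochner_Integration.integral_sum)
      (auto intro!: integrable_continuous_on_sphere continuous_intros)
  also have "\<dots> = (\<Sum>i\<in>I. \<Sum>j\<in>I. \<Sum>M\<in>I. \<Sum>M'\<in>I. triple i j M * triple i j M' * Y M' y * Y M x)"
  proof (intro sum.cong refl)
    fix i j assume "i \<in> I" "j \<in> I"
    then have "product_proj i j y * product_proj i j x =
        (\<Sum>M\<in>I. triple i j M * Y M x) * (\<Sum>M'\<in>I. triple i j M' * Y M' y)"
      by (simp add: product_proj_eq mult.commute)
    then show "product_proj i j y * product_proj i j x =
        (\<Sum>M\<in>I. \<Sum>M'\<in>I. triple i j M * triple i j M' * Y M' y * Y M x)"
      by (simp add: sum_product mult_ac)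
  qed
  also have "\<dots> = (\<Sum>M\<in>I. \<Sum>i\<in>I. \<Sum>j\<in>I. \<Sum>M'\<in>I. triple i j M * triple i j M' * Y M' y * Y M x)"
    by (rule sum_rotate)
  also have "\<dots> = (\<Sum>M\<in>I. \<Sum>M'\<in>I. \<Sum>i\<in>I. \<Sum>j\<in>I. triple i j M * triple i j M' * Y M' y * Y M x)"
    by (rule sum.cong[OF refl], rule sum_rotate)
  also have "\<dots> = (\<Sum>M\<in>I. (\<Sum>M'\<in>I. gram M M' * Y M' y) * Y M x)"
    by (simp add: gram_def sum_distrib_right)
  finally show ?thesis .
qed

lemma gram_kernel_eigen: "(\<lambda>x. gram_kernel x y) \<in> laplace_beltrami_eigenspace c"
  unfolding gram_kernel_eq by (rule eigenspace_linear_combination[OF Y_eigen])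

text \<open>
  The inner integral is \<open>square_proj u u\<close>; expanded in the basis and integrated over \<open>u\<close>, it
  becomes the sum of the squares of all triple integrals.
\<close>

lemma gram_trace:
  "(\<Sum>M\<in>I. gram M M) = (\<integral>u. (\<integral>v. K u v ^ 3 \<partial>sphere_measure) \<partial>sphere_measure)"
proof -
  have "(\<integral>v. K u v ^ 3 \<partial>sphere_measure) = square_proj u u" for u
    by (simp add: square_proj_def power3_eq_cube power2_eq_square mult_ac)
  also have "square_proj u u = (\<Sum>i\<in>I. \<Sum>j\<in>I. \<Sum>M\<in>I. triple i j M * (Y i u * Y j u * Y M u))" for u
    unfolding square_proj_eq
    by (intro sum.cong refl) (simp add: product_proj_eq sum_distrib_left mult_ac)
  finally have "(\<integral>u. (\<integral>v. K u v ^ 3 \<partial>sphere_measure) \<partial>sphere_measure) =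
      (\<integral>u. (\<Sum>i\<in>I. \<Sum>j\<in>I. \<Sum>M\<in>I. triple i j M * (Y i u * Y j u * Y M u)) \<partial>sphere_measure)"
    by simp
  also have "\<dots> = (\<Sum>i\<in>I. \<Sum>j\<in>I. \<Sum>M\<in>I. triple i j M * triple i j M)"
  proof -
    have int: "integrable sphere_measure (\<lambda>u. triple i j M * (Y i u * Y j u * Y M u))"
      if "i \<in> I" "j \<in> I" "M \<in> I" for i j M
      using that by (intro integrable_continuous_on_sphere continuous_intros)
    let ?t = "\<lambda>i j M u. triple i j M * (Y i u * Y j u * Y M u)"
    have "(\<integral>u. (\<Sum>i\<in>I. \<Sum>j\<in>I. \<Sum>M\<in>I. ?t i j M u) \<partial>sphere_measure) =
        (\<Sum>i\<in>I. \<integral>u. (\<Sum>j\<in>I. \<Sum>M\<in>I. ?t i j M u) \<partial>sphere_measure)"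
      by (intro Bochner_Integration.integral_sum Bochner_Integration.integrable_sum int)
    also have "\<dots> = (\<Sum>i\<in>I. \<Sum>j\<in>I. \<integral>u. (\<Sum>M\<in>I. ?t i j M u) \<partial>sphere_measure)"
      by (intro sum.cong refl Bochner_Integration.integral_sum Bochner_Integration.integrable_sum int)
    also have "\<dots> = (\<Sum>i\<in>I. \<Sum>j\<in>I. \<Sum>M\<in>I. \<integral>u. ?t i j M u \<partial>sphere_measure)"
      by (intro sum.cong refl Bochner_Integration.integral_sum int)
    finally show ?thesis by (simp add: triple_def)
  qed
  also have "\<dots> = (\<Sum>M\<in>I. gram M M)"
    unfolding gram_def by (rule sum_rotate)
  finally show ?thesis by simp
qed

end

section \<open>The Gram matrix of the triple integrals\<close>

text \<open>
  The factor \<open>\<mu>\<close> between the invariant kernels \<open>gram_kernel\<close> and \<open>K\<close> is the diagonal entry of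
  the Gram matrix, and \<open>gram_trace\<close> evaluates it.
\<close>

theorem lemma1p5:
  fixes Y :: "nat \<Rightarrow> nat \<Rightarrow> real ^ 'n \<Rightarrow> real"
    and d l M M' :: nat
  assumes "d \<ge> 2"
    and "CARD('n::finite) = d + 1"
    and "CARD('k::finite) = d"
    and "l \<ge> 1" and "even l"
    and "L2_orthonormal_basis (laplace_beltrami_eigenspace (- (real l * (real l + real d - 1))))
           {1..harmonic_dim l d} (Y l)"
    and "M \<in> {1..harmonic_dim l d}" and "M' \<in> {1..harmonic_dim l d}"
  shows "(\<Sum>m1 = 1..harmonic_dim l d. \<Sum>m2 = 1..harmonic_dim l d.
            triple_integral Y l m1 l m2 l M * triple_integral Y l m1 l m2 l M') =
         (if M = M' then 1 else 0) *
         ((real (harmonic_dim l d))\<^sup>2 / sphere_area TYPE(real ^ 'n)) *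
         (sphere_area TYPE(real ^ 'k) / sphere_area TYPE(real ^ 'n)) *
         integral {-1..1} (\<lambda>t. gegenbauer l d t ^ 3 * sqrt (1 - t\<^sup>2) ^ (d - 2))"
proof -
  define I where "I = {1..harmonic_dim l d}"
  let ?N = "real (harmonic_dim l d)"
  let ?S = "sphere_area TYPE(real^'n)"
  let ?J = "sphere_area TYPE(real^'k) * integral {-1..1} (\<lambda>t. gegenbauer l d t ^ 3 * sqrt (1 - t\<^sup>2) ^ (d - 2))"
  interpret eigenspace_basis "- (real l * (real l + real d - 1))" I "Y l"
    using assms(6) unfolding I_def by unfold_locales
  obtain \<kappa> where K: "\<And>x y. norm x = 1 \<Longrightarrow> norm y = 1 \<Longrightarrow> K x y = \<kappa> * gegenbauer l d (x \<bullet> y)"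
    using invariant_kernel_eq_gegenbauer[where k = K, OF assms(2,1,4) K_eigen K_invariant] by blast
  obtain \<beta> where gram_kernel: "\<And>x y. norm x = 1 \<Longrightarrow> norm y = 1 \<Longrightarrow> gram_kernel x y = \<beta> * gegenbauer l d (x \<bullet> y)"
    using invariant_kernel_eq_gegenbauer[where k = gram_kernel, OF assms(2,1,4) gram_kernel_eigen gram_kernel_invariant] by blast
  \<comment> \<open>Integrate \<open>K x x = \<kappa>\<close> over the sphere.\<close>
  have N: "\<kappa> * ?S = ?N"
  proof -
    have "\<kappa> * ?S = (\<integral>x. \<kappa> \<partial>(sphere_measure :: (real^'n) measure))"
      by (simp only: integral_sphere_const)
    also have "\<dots> = (\<integral>x. K x x \<partial>(sphere_measure :: (real^'n) measure))"
      using assms(1) by (intro Bochner_Integration.integral_cong refl)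
        (simp add: K gegenbauer_at_1 norm_eq_1)
    also have "\<dots> = (\<Sum>i\<in>I. \<integral>x. Y l i x * Y l i x \<partial>sphere_measure)"
      unfolding K_def by (intro Bochner_Integration.integral_sum integrable_YY)
    also have "\<dots> = (\<Sum>i\<in>I. 1)" by (intro sum.cong refl) (simp add: orthonormal)
    finally show ?thesis by (simp add: I_def)
  qed
  have "?N > 0" using assms(7) by simp
  have "\<kappa> \<noteq> 0" using N \<open>?N > 0\<close> by auto
  define \<mu> where "\<mu> = \<beta> / \<kappa>"
  have gram_K: "gram_kernel x y = \<mu> * K x y" if "norm x = 1" "norm y = 1" for x y
    using that \<open>\<kappa> \<noteq> 0\<close> by (simp add: gram_kernel K \<mu>_def)
  \<comment> \<open>Both kernels being proportional, compare their coefficients in the orthonormal basis.\<close>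
  have gram: "gram i j = (if i = j then \<mu> else 0)" if i: "i \<in> I" and j: "j \<in> I" for i j
  proof -
    have row: "(\<Sum>M'\<in>I. gram i M' * Y l M' y) = \<mu> * Y l i y" if y: "norm y = 1" for y
    proof -
      have "(\<Sum>M'\<in>I. gram i M' * Y l M' y) = (\<integral>x. gram_kernel x y * Y l i x \<partial>sphere_measure)"
        unfolding gram_kernel_eq by (rule integral_Y_lincomb[OF i, symmetric])
      also have "\<dots> = (\<integral>x. \<mu> * (K y x * Y l i x) \<partial>sphere_measure)"
        using y by (intro Bochner_Integration.integral_cong refl) (simp add: gram_K K_commute)
      also have "\<dots> = \<mu> * Y l i y" using reproducing[OF Y_eigen[OF i] y] by simp
      finally show ?thesis .
    qed
    have "gram i j = (\<integral>y. (\<Sum>M'\<in>I. gram i M' * Y l M' y) * Y l j y \<partial>sphere_measure)"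
      by (rule integral_Y_lincomb[OF j, symmetric])
    also have "\<dots> = (\<integral>y. \<mu> * (Y l i y * Y l j y) \<partial>sphere_measure)"
      by (intro Bochner_Integration.integral_cong refl) (simp add: row)
    also have "\<dots> = \<mu> * (\<integral>y. Y l i y * Y l j y \<partial>sphere_measure)" by (rule integral_mult_right_zero)
    finally show ?thesis by (simp only: orthonormal[OF i j]) simp
  qed
  have "?N * \<mu> = (\<Sum>M\<in>I. gram M M)" by (simp add: gram) (simp add: I_def)
  also have "\<dots> = (\<integral>u. (\<integral>v. K u v ^ 3 \<partial>sphere_measure) \<partial>sphere_measure)" by (rule gram_trace)
  also have "\<dots> = (\<integral>u. \<kappa> ^ 3 * ?J \<partial>(sphere_measure :: (real^'n) measure))"
  proof (intro Bochner_Integration.integral_cong refl)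
    fix u :: "real^'n" assume "u \<in> space sphere_measure"
    then have u: "norm u = 1" by simp
    have "(\<integral>v. K u v ^ 3 \<partial>sphere_measure) = (\<integral>v. \<kappa> ^ 3 * gegenbauer l d (u \<bullet> v) ^ 3 \<partial>sphere_measure)"
      by (intro Bochner_Integration.integral_cong refl) (simp add: K u power_mult_distrib)
    also have "\<dots> = \<kappa> ^ 3 * ?J"
      unfolding integral_sphere_gegenbauer_cube[OF assms(1,2,3) u, of l, symmetric] by simp
    finally show "(\<integral>v. K u v ^ 3 \<partial>sphere_measure) = \<kappa> ^ 3 * ?J" .
  qed
  also have "\<dots> = (\<kappa> * ?S) * (\<kappa>\<^sup>2 * ?J)"
    unfolding integral_sphere_const by (simp add: power2_eq_square power3_eq_cube)
  finally have "\<mu> = \<kappa>\<^sup>2 * ?J" using \<open>?N > 0\<close> unfolding N by simp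
  also have "\<kappa> = ?N / ?S" using N sphere_area_pos[where 'a = "real^'n"] by (simp add: field_simps)
  finally have \<mu>: "\<mu> = (?N / ?S)\<^sup>2 * ?J" .
  have "(\<Sum>m1 = 1..harmonic_dim l d. \<Sum>m2 = 1..harmonic_dim l d.
      triple_integral Y l m1 l m2 l M * triple_integral Y l m1 l m2 l M') = gram M M'"
    unfolding I_def[symmetric] by (simp only: gram_def triple_def triple_integral_def)
  also have "\<dots> = (if M = M' then 1 else 0) * \<mu>" using gram[OF assms(7,8)[folded I_def]] by simp
  finally show ?thesis unfolding \<mu> by (simp add: power2_eq_square)
qed

end
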